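(* Let $y = Ax^* + \epsilon$ with $x^*\in\mathbb{R}^p$. Let $S = S(x^* )=\{i\in\{1,\ldots,p-1\}: x^*_i\neq x^*_{i+1}\}$ with $|S| = s \ge 1$, and let $H = \{j: x^*_j\neq 0\}\subset\{1,\ldots,p\}$ with $|H| = h$. Assume that the design matrix $A\in\mathbb{R}^{n\times p}$ has rows $\{n^{-1/2}a_i^\top\}_{i=1}^n$, where $\{a_i\}_{i=1}^n$ are independent and identically distributed as $\mathcal{N}(0,\Sigma)$ with $\sigma_{\min}(\Sigma)\geq l>0$ and $\|\Sigma\|_\infty\leq\rho$, where $l$ and $\rho$ are absolute constants. Suppose that $\epsilon\sim\mathcal{N}(0,\sigma^2I_n)$ is independent of $A$ and that $(s+h)\log(p)\leq C_1 n$, where $C_1>0$ is a sufficiently small constant. Let \[ \tilde{x} \in \operatorname*{arg\,min}_{x\in\mathbb{R}^p}\left\{\|y-Ax\|^2+\lambda_1\|x\|_1+\lambda_2\|Dx\|_1\right\} \] with $\lambda_1 = C_{\lambda_1}\sigma\sqrt{\rho\log(p\vee n)}$ and $\lambda_2 = C_{\lambda_2}\sigma\sqrt{\log(p\vee n)}$, where $C_{\lambda_1},C_{\lambda_2}>0$ are sufficiently large absolute constants. Then, with probability at least $1-c_1(p\vee n)^{-1}-p\exp(-n)-c_2\exp(-c_3n)$, \[ \|\tilde{x}-x^*\|^2\leq C\sigma^2\log(p\vee n)(s\vee h), \] where $C, c_1,c_2,c_3>0$ are absolute constants.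
   Context: $\|\cdot\|$ and $\|\cdot\|_1$ are the $\ell_2$- and $\ell_1$-norms of a vector; $\|\Sigma\|_\infty$ is the entrywise supremum norm of a matrix; $\sigma_{\min}(\cdot)$ is the smallest singular value; $a\vee b=\max\{a,b\}$. $D\in\mathbb{R}^{(p-1)\times p}$ is the difference operator $D_{ij}=\mathbf{1}\{i=j\}-\mathbf{1}\{j-i=1\}$, so $(Dv)_i=v_i-v_{i+1}$. The dimension $p$ may depend on $n$. Since $l$ and $\rho$ are treated as absolute constants, the other absolute constants may depend on them (and on $C_{\lambda_1}, C_{\lambda_2}$), but not on $n,p,s,h,\sigma,x^*$. *)

theory Defs
  imports
    "HOL-Probability.Probability"
    "Jordan_Normal_Form.Matrix"
    "Jordan_Normal_Form.Char_Poly"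
    "Jordan_Normal_Form.Spectral_Radius"
begin

hide_const (open) Finite_Cartesian_Product.vec
hide_type (open) Finite_Cartesian_Product.vec
no_notation Finite_Cartesian_Product.vec_nth (infixl \<open>$\<close> 90)
no_notation inner (infix \<open>\<bullet>\<close> 70)

text \<open>
  Dimensions vary inside the statement, so vectors and matrices are those of
  Jordan_Normal_Form, with indices starting at 0.
\<close>

definition vec_l2_norm :: "real vec \<Rightarrow> real" where
  "vec_l2_norm v = L2_set (\<lambda>i. v $ i) {..<dim_vec v}"

definition vec_l1_norm :: "real vec \<Rightarrow> real" where
  "vec_l1_norm v = (\<Sum>i<dim_vec v. \<bar>v $ i\<bar>)"

definition mat_sup_norm :: "real mat \<Rightarrow> real" where
  "mat_sup_norm B = Max (abs ` elements_mat B)"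

text \<open>
  The singular values of \<open>B\<close> are the square roots of the eigenvalues of \<open>B\<^sup>T B\<close>
  (used for nonempty square matrices only).
\<close>

definition smallest_singular_value :: "real mat \<Rightarrow> real" where
  "smallest_singular_value B = Min (sqrt ` spectrum (transpose_mat B * B))"

definition diff_mat :: "nat \<Rightarrow> real mat" where
  "diff_mat p = mat (p - 1) p
     (\<lambda>(i, j). (if i = j then 1 else 0) - (if j = i + 1 then 1 else 0))"

definition jump_set :: "real vec \<Rightarrow> nat set" where
  "jump_set v = {i. i + 1 < dim_vec v \<and> v $ i \<noteq> v $ (i + 1)}"

definition support_set :: "real vec \<Rightarrow> nat set" where
  "support_set v = {j. j < dim_vec v \<and> v $ j \<noteq> 0}"

definition normal_law :: "real \<Rightarrow> real \<Rightarrow> real measure" where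
  "normal_law m v =
     (if v = 0 then return borel m
      else density lborel (\<lambda>x. ennreal (normal_density m (sqrt v) x)))"

text \<open>
  \<open>multivariate_normal p \<mu> \<Sigma> N\<close>: the measure \<open>N\<close> on \<open>p\<close>-tuples of reals is the law
  \<open>N(\<mu>, \<Sigma>)\<close>, that is, \<open>\<Sigma>\<close> is symmetric positive semidefinite and every linear functional
  \<open>z \<mapsto> u \<bullet> z\<close> has the one-dimensional law \<open>N(u \<bullet> \<mu>, u \<bullet> \<Sigma> u)\<close>.
\<close>

definition multivariate_normal ::
    "nat \<Rightarrow> real vec \<Rightarrow> real mat \<Rightarrow> (nat \<Rightarrow> real) measure \<Rightarrow> bool" where
  "multivariate_normal p \<mu> \<Sigma> N \<longleftrightarrow>
     \<mu> \<in> carrier_vec p \<and> \<Sigma> \<in> carrier_mat p p \<and> transpose_mat \<Sigma> = \<Sigma> \<and>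
     (\<forall>u\<in>carrier_vec p. 0 \<le> u \<bullet> (\<Sigma> *\<^sub>v u)) \<and>
     prob_space N \<and> sets N = sets (PiM {..<p} (\<lambda>_. borel)) \<and>
     (\<forall>u\<in>carrier_vec p.
        distr N borel (\<lambda>z. u \<bullet> vec p z) = normal_law (u \<bullet> \<mu>) (u \<bullet> (\<Sigma> *\<^sub>v u)))"

text \<open>
  The joint law of \<open>(a, e)\<close> where the \<open>n\<close> vectors \<open>a 0, \<dots>, a (n - 1)\<close> are i.i.d.\ with law
  \<open>Na\<close> and \<open>e\<close> has law \<open>Ne\<close> and is independent of \<open>a\<close>. The statement speaks about
  this law, and not about random variables on a probability space over an arbitrary type,
  because otherwise its absolute constants would be allowed to depend on that type. The lemma
  below recovers the formulation with random variables.
\<close>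

definition sample_law ::
    "nat \<Rightarrow> (nat \<Rightarrow> real) measure \<Rightarrow> (nat \<Rightarrow> real) measure
       \<Rightarrow> ((nat \<Rightarrow> nat \<Rightarrow> real) \<times> (nat \<Rightarrow> real)) measure" where
  "sample_law n Na Ne = (\<Pi>\<^sub>M i\<in>{..<n}. Na) \<Otimes>\<^sub>M Ne"

lemma (in prob_space) distr_eq_sample_law:
  fixes n :: nat and a :: "nat \<Rightarrow> 'a \<Rightarrow> nat \<Rightarrow> real" and e :: "'a \<Rightarrow> nat \<Rightarrow> real"
  defines "a' \<equiv> \<lambda>\<omega>. \<lambda>i\<in>{..<n}. a i \<omega>"
  assumes n: "n > 0"
    and a: "indep_vars (\<lambda>_. Va) a {..<n}" "\<And>i. i < n \<Longrightarrow> distr M Va (a i) = Na"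
    and e: "random_variable Ve e" "distr M Ve e = Ne"
    and indep: "indep_set {a' -` X \<inter> space M | X. X \<in> sets (\<Pi>\<^sub>M i\<in>{..<n}. Va)}
                          {e -` Y \<inter> space M | Y. Y \<in> sets Ve}"
  shows "distr M ((\<Pi>\<^sub>M i\<in>{..<n}. Va) \<Otimes>\<^sub>M Ve) (\<lambda>\<omega>. (a' \<omega>, e \<omega>)) = sample_law n Na Ne"
proof -
  let ?V = "\<Pi>\<^sub>M i\<in>{..<n}. Va"
  have rv_i: "random_variable Va (a i)" if "i < n" for i
    using a(1) that by (auto simp: indep_vars_def)
  have rv[measurable]: "a' \<in> M \<rightarrow>\<^sub>M ?V" "e \<in> M \<rightarrow>\<^sub>M Ve"
    unfolding a'_def by (auto intro!: measurable_restrict rv_i e(1))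
  have "distr M ?V a' = (\<Pi>\<^sub>M i\<in>{..<n}. distr M Va (a i))"
    using indep_vars_iff_distr_eq_PiM'[of "{..<n}" a "\<lambda>_. Va"] a(1) n rv_i
    unfolding a'_def by auto
  also have "\<dots> = (\<Pi>\<^sub>M i\<in>{..<n}. Na)"
    by (intro PiM_cong) (auto simp: a(2))
  finally have law_a: "distr M ?V a' = (\<Pi>\<^sub>M i\<in>{..<n}. Na)" .
  interpret P: prob_space "distr M ?V a'" by (rule prob_space_distr) simp
  interpret Q: prob_space "distr M Ve e" by (rule prob_space_distr) simp
  have "distr M ?V a' \<Otimes>\<^sub>M distr M Ve e = distr M (?V \<Otimes>\<^sub>M Ve) (\<lambda>\<omega>. (a' \<omega>, e \<omega>))"
  proof (rule pair_measure_eqI)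
    show "sigma_finite_measure (distr M ?V a')" "sigma_finite_measure (distr M Ve e)"
      by unfold_locales
    show "sets (distr M ?V a' \<Otimes>\<^sub>M distr M Ve e) =
        sets (distr M (?V \<Otimes>\<^sub>M Ve) (\<lambda>\<omega>. (a' \<omega>, e \<omega>)))"
      by simp
    fix X Y
    assume "X \<in> sets (distr M ?V a')" "Y \<in> sets (distr M Ve e)"
    then have X[measurable]: "X \<in> sets ?V" and Y[measurable]: "Y \<in> sets Ve" by auto
    have "prob ((a' -` X \<inter> space M) \<inter> (e -` Y \<inter> space M)) =
        prob (a' -` X \<inter> space M) * prob (e -` Y \<inter> space M)"
      by (rule indep_setD[OF indep]) (use X Y in auto)
    moreover have "(\<lambda>\<omega>. (a' \<omega>, e \<omega>)) -` (X \<times> Y) \<inter> space M =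
        (a' -` X \<inter> space M) \<inter> (e -` Y \<inter> space M)"
      by auto
    ultimately show "emeasure (distr M ?V a') X * emeasure (distr M Ve e) Y =
        emeasure (distr M (?V \<Otimes>\<^sub>M Ve) (\<lambda>\<omega>. (a' \<omega>, e \<omega>))) (X \<times> Y)"
      by (simp add: emeasure_distr emeasure_eq_measure ennreal_mult)
  qed
  then show ?thesis
    by (simp add: sample_law_def law_a e(2))
qed

definition design_mat :: "nat \<Rightarrow> nat \<Rightarrow> (nat \<Rightarrow> nat \<Rightarrow> real) \<Rightarrow> real mat" where
  "design_mat n p a = mat n p (\<lambda>(i, j). a i j / sqrt (real n))"

definition fused_lasso_objective ::
    "real \<Rightarrow> real \<Rightarrow> real vec \<Rightarrow> real mat \<Rightarrow> real vec \<Rightarrow> real" where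
  "fused_lasso_objective lam\<^sub>1 lam\<^sub>2 y A x =
     (vec_l2_norm (y - A *\<^sub>v x))\<^sup>2 + lam\<^sub>1 * vec_l1_norm x
       + lam\<^sub>2 * vec_l1_norm (diff_mat (dim_vec x) *\<^sub>v x)"

end

theory Submission
  imports Defs
begin

text \<open>
  Once \<open>4 \<parallel>A\<^sup>T \<epsilon>\<parallel>\<^sub>\<infinity> \<le> \<lambda>\<^sub>1\<close>, optimality of \<open>x\<close> puts the error \<open>v = x - x\<^sub>0\<close> in the cone
  \<open>\<parallel>v\<parallel>\<^sub>1 \<le> K \<surd>(s + h) \<parallel>v\<parallel>\<close> and bounds \<open>\<parallel>Av\<parallel>\<^sup>2\<close> linearly in \<open>\<parallel>v\<parallel>\<close>, so a restricted eigenvalue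
  condition on this cone suffices. It is obtained without Gaussian comparison
  inequalities, by Maurey's empirical method: a union bound over the at most \<open>(2p)\<^sup>d\<close> sums \<open>u\<close> of
  \<open>d\<close> signed unit vectors gives \<open>\<parallel>Au\<parallel>\<^sup>2 \<ge> u\<^sup>T\<Sigma>u / 4\<close> for all of them, and averaging over random
  such sums with mean proportional to \<open>v\<close> transfers this to
  \<open>\<parallel>Av\<parallel>\<^sup>2 \<ge> v\<^sup>T\<Sigma>v / 4 - 5 \<rho> \<parallel>v\<parallel>\<^sub>1\<^sup>2 / (d - 1)\<close> for all \<open>v\<close>, with the column bound
  \<open>\<parallel>A\<^sub>j\<parallel>\<^sup>2 \<le> 5 \<rho>\<close>. A multiple of \<open>s + h\<close> is enough for \<open>d\<close>.
\<close>

section \<open>Gaussian tails\<close>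

lemma nn_integral_normal_law_exp_square:
  fixes w s :: real
  assumes "w > 0" "s > -1"
  shows "(\<integral>\<^sup>+x. ennreal (exp (- (s * x\<^sup>2 / (2 * w)))) \<partial>normal_law 0 w) = ennreal (1 / sqrt (1 + s))"
proof -
  define \<tau> where "\<tau> = sqrt (w / (1 + s))"
  have pos: "\<tau> > 0" and sq: "\<tau>\<^sup>2 = w / (1 + s)"
    using assms by (auto simp: \<tau>_def)
  have tilt: "normal_density 0 (sqrt w) x * exp (- (s * x\<^sup>2 / (2 * w))) =
      1 / sqrt (1 + s) * normal_density 0 \<tau> x" for x
  proof -
    have "exp (- (x\<^sup>2 / (2 * w))) * exp (- (s * x\<^sup>2 / (2 * w))) = exp (- (x\<^sup>2 / (2 * \<tau>\<^sup>2)))"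
      unfolding mult_exp_exp sq using assms by (simp add: field_simps)
    moreover have "sqrt (2 * pi * w) = sqrt (1 + s) * sqrt (2 * pi * \<tau>\<^sup>2)"
      unfolding real_sqrt_mult[symmetric] sq using assms by simp
    ultimately show ?thesis
      using assms by (simp add: normal_density_def)
  qed
  have "(\<integral>\<^sup>+x. ennreal (exp (- (s * x\<^sup>2 / (2 * w)))) \<partial>normal_law 0 w) =
      (\<integral>\<^sup>+x. ennreal (normal_density 0 (sqrt w) x) * ennreal (exp (- (s * x\<^sup>2 / (2 * w)))) \<partial>lborel)"
    using assms unfolding normal_law_def by (simp add: nn_integral_density)
  also have "\<dots> = (\<integral>\<^sup>+x. ennreal (1 / sqrt (1 + s)) * ennreal (normal_density 0 \<tau> x) \<partial>lborel)"
    using assms by (intro nn_integral_cong) (simp add: ennreal_mult[symmetric] tilt)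
  also have "\<dots> = ennreal (1 / sqrt (1 + s)) * (\<integral>\<^sup>+x. ennreal (normal_density 0 \<tau> x) \<partial>lborel)"
    by (rule nn_integral_cmult) simp
  also have "(\<integral>\<^sup>+x. ennreal (normal_density 0 \<tau> x) \<partial>lborel) = 1"
    using nn_integral_eq_integral[OF integrable_normal_density[of \<tau> 0]] pos by simp
  finally show ?thesis by simp
qed

lemma nn_integral_PiM_exp_square:
  fixes w s :: real and f :: "'a \<Rightarrow> real" and n :: nat
  assumes N: "prob_space N" and [measurable]: "f \<in> borel_measurable N"
    and law: "distr N borel f = normal_law 0 w" and "w > 0" "s > -1"
  shows "(\<integral>\<^sup>+a. ennreal (exp (- (s * (\<Sum>i<n. (f (a i))\<^sup>2) / (2 * w)))) \<partial>(\<Pi>\<^sub>M i\<in>{..<n}. N)) =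
      ennreal ((1 / sqrt (1 + s)) ^ n)"
proof -
  interpret N: prob_space N by fact
  interpret product_prob_space "\<lambda>i. N" "{..<n}" by unfold_locales
  let ?g = "\<lambda>x. ennreal (exp (- (s * x\<^sup>2 / (2 * w))))"
  have "(\<integral>\<^sup>+a. ennreal (exp (- (s * (\<Sum>i<n. (f (a i))\<^sup>2) / (2 * w)))) \<partial>(\<Pi>\<^sub>M i\<in>{..<n}. N)) =
      (\<integral>\<^sup>+a. (\<Prod>i<n. ?g (f (a i))) \<partial>(\<Pi>\<^sub>M i\<in>{..<n}. N))"
    by (intro nn_integral_cong)
      (simp add: prod_ennreal exp_sum[symmetric] sum_distrib_left sum_divide_distrib sum_negf)
  also have "\<dots> = (\<Prod>i<n. \<integral>\<^sup>+z. ?g (f z) \<partial>N)"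
    by (rule product_nn_integral_prod) auto
  also have "(\<integral>\<^sup>+z. ?g (f z) \<partial>N) = (\<integral>\<^sup>+x. ?g x \<partial>distr N borel f)"
    by (subst nn_integral_distr) auto
  also have "\<dots> = ennreal (1 / sqrt (1 + s))"
    unfolding law by (rule nn_integral_normal_law_exp_square) fact+
  finally show ?thesis
    using assms(5) by (simp add: ennreal_power)
qed

text \<open>The Chernoff factor per observation in the lower tail, where s = 3 makes
  \<open>1 / sqrt (1 + s)\<close> equal to 1/2. It amounts to exp(5/8) \<le> 2.\<close>

lemma exp_neg_quarter_le: "exp (3/8::real) / 2 \<le> exp (-1/4)"
proof -
  have "exp (5/8::real) \<le> exp (ln 2)"
    using ln2_ge_two_thirds by (subst exp_le_cancel_iff) simp
  then have "exp (-1/4::real) * exp (5/8) \<le> exp (-1/4) * 2"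
    by (intro mult_left_mono) auto
  then show ?thesis by (simp add: mult_exp_exp)
qed

text \<open>The Chernoff factor per observation in the upper tail, where s = -3/4 makes
  \<open>1 / sqrt (1 + s)\<close> equal to 2. It amounts to 2 \<le> exp(7/8).\<close>

lemma two_exp_le: "2 * exp (- 15/8::real) \<le> exp (-1)"
proof -
  have "exp (ln 2) \<le> exp (7/8::real)"
    using ln2_le_25_over_36 by (subst exp_le_cancel_iff) simp
  then have "2 * exp (-15/8) \<le> exp (7/8) * exp (-15/8::real)"
    by (intro mult_right_mono) auto
  then show ?thesis by (simp add: mult_exp_exp)
qed

text \<open>Markov's inequality for the weight with s = 3: on the event the weight exceeds
  exp(-3n/8), while its mean is 2^(-n). The rate 1/4 is what the union bound over the signed sums
  later has to beat.\<close>

lemma chi_square_lower_tail: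
  fixes w :: real and f :: "'a \<Rightarrow> real" and n :: nat
  assumes N: "prob_space N" and f[measurable]: "f \<in> borel_measurable N"
    and law: "distr N borel f = normal_law 0 w" and "w > 0"
  shows "measure (\<Pi>\<^sub>M i\<in>{..<n}. N)
      {a \<in> space (\<Pi>\<^sub>M i\<in>{..<n}. N). (\<Sum>i<n. (f (a i))\<^sup>2) < real n * w / 4} \<le> exp (- real n / 4)"
    (is "measure ?P ?B \<le> _")
proof -
  interpret N: prob_space N by fact
  interpret product_prob_space "\<lambda>i. N" "{..<n}" by unfold_locales
  let ?g = "\<lambda>a. ennreal (exp (- (3 * (\<Sum>i<n. (f (a i))\<^sup>2) / (2 * w))))"
  have [measurable]: "(\<lambda>a. f (a i)) \<in> borel_measurable ?P" if "i < n" for i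
    using that by simp
  have "emeasure ?P ?B \<le> emeasure ?P {a \<in> space ?P. 1 \<le> ennreal (exp (3/8 * real n)) * ?g a}"
  proof (rule emeasure_mono)
    show "?B \<subseteq> {a \<in> space ?P. 1 \<le> ennreal (exp (3/8 * real n)) * ?g a}"
      using \<open>w > 0\<close> by (auto simp: ennreal_mult[symmetric] mult_exp_exp field_simps)
  qed measurable
  also have "\<dots> \<le> ennreal (exp (3/8 * real n)) * (\<integral>\<^sup>+a. ?g a * indicator (space ?P) a \<partial>?P)"
    using nn_integral_Markov_inequality[of ?g "space ?P" ?P "ennreal (exp (3/8 * real n))"]
    by measurable
  also have "(\<integral>\<^sup>+a. ?g a * indicator (space ?P) a \<partial>?P) = (\<integral>\<^sup>+a. ?g a \<partial>?P)"
    by (intro nn_integral_cong) simp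
  also have "\<dots> = ennreal ((1/2) ^ n)"
    using nn_integral_PiM_exp_square[OF N f law \<open>w > 0\<close>, of 3 n] by simp
  also have "ennreal (exp (3/8 * real n)) * ennreal ((1/2) ^ n) = ennreal ((exp (3/8) / 2) ^ n)"
    unfolding exp_of_nat2_mult by (simp add: ennreal_mult[symmetric] power_divide)
  also have "\<dots> \<le> ennreal (exp (-1/4) ^ n)"
    by (intro ennreal_leI power_mono exp_neg_quarter_le) auto
  finally show ?thesis
    by (simp add: emeasure_eq_measure exp_of_nat2_mult[symmetric])
qed

text \<open>Markov's inequality for the weight with s = -3/4: on the event it exceeds exp(15n/8),
  while its mean is 2^n. The factor 5 yields the full rate exp(-n) of the theorem.\<close>

lemma chi_square_upper_tail:
  fixes w :: real and f :: "'a \<Rightarrow> real" and n :: nat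
  assumes N: "prob_space N" and f[measurable]: "f \<in> borel_measurable N"
    and law: "distr N borel f = normal_law 0 w" and "w > 0"
  shows "measure (\<Pi>\<^sub>M i\<in>{..<n}. N)
      {a \<in> space (\<Pi>\<^sub>M i\<in>{..<n}. N). (\<Sum>i<n. (f (a i))\<^sup>2) > 5 * real n * w} \<le> exp (- real n)"
    (is "measure ?P ?B \<le> _")
proof -
  interpret N: prob_space N by fact
  interpret product_prob_space "\<lambda>i. N" "{..<n}" by unfold_locales
  let ?g = "\<lambda>a. ennreal (exp (- (- (3/4) * (\<Sum>i<n. (f (a i))\<^sup>2) / (2 * w))))"
  have [measurable]: "(\<lambda>a. f (a i)) \<in> borel_measurable ?P" if "i < n" for i
    using that by simp
  have "emeasure ?P ?B \<le> emeasure ?P {a \<in> space ?P. 1 \<le> ennreal (exp (-15/8 * real n)) * ?g a}"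
  proof (rule emeasure_mono)
    show "?B \<subseteq> {a \<in> space ?P. 1 \<le> ennreal (exp (-15/8 * real n)) * ?g a}"
      using \<open>w > 0\<close> by (auto simp: ennreal_mult[symmetric] mult_exp_exp field_simps)
  qed measurable
  also have "\<dots> \<le> ennreal (exp (-15/8 * real n)) * (\<integral>\<^sup>+a. ?g a * indicator (space ?P) a \<partial>?P)"
    using nn_integral_Markov_inequality[of ?g "space ?P" ?P "ennreal (exp (-15/8 * real n))"]
    by measurable
  also have "(\<integral>\<^sup>+a. ?g a * indicator (space ?P) a \<partial>?P) = (\<integral>\<^sup>+a. ?g a \<partial>?P)"
    by (intro nn_integral_cong) simp
  also have "\<dots> = ennreal (2 ^ n)"
    using nn_integral_PiM_exp_square[OF N f law \<open>w > 0\<close>, of "-3/4" n] by (simp add: real_sqrt_divide)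
  also have "ennreal (exp (-15/8 * real n)) * ennreal (2 ^ n) = ennreal ((2 * exp (-15/8)) ^ n)"
    unfolding exp_of_nat2_mult by (simp add: ennreal_mult[symmetric] power_mult_distrib mult.commute)
  also have "\<dots> \<le> ennreal (exp (-1) ^ n)"
    by (intro ennreal_leI power_mono two_exp_le) auto
  finally show ?thesis
    by (simp add: emeasure_eq_measure exp_of_nat2_mult[symmetric])
qed

text \<open>The weight with s = -3/4 for a single variable; its mean is 2. The bound
  \<open>v\<close> on the variance is there because, given the design, the variance of a noise
  correlation is controlled only from above. The Dirac case \<open>w = 0\<close> puts no mass beyond
  \<open>t > 0\<close>.\<close>

lemma normal_law_tail:
  fixes w t :: real and f :: "'a \<Rightarrow> real"
  assumes N: "prob_space N" and f[measurable]: "f \<in> borel_measurable N"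
    and law: "distr N borel f = normal_law 0 w" and "0 \<le> w" "w \<le> v" "v > 0" "t > 0"
  shows "measure N {z \<in> space N. \<bar>f z\<bar> > t} \<le> 2 * exp (- (3 * t\<^sup>2 / (8 * v)))"
proof -
  interpret N: prob_space N by fact
  let ?B = "{x. \<bar>x\<bar> > t}"
  have B: "measure N {z \<in> space N. \<bar>f z\<bar> > t} = measure (normal_law 0 w) ?B"
    unfolding law[symmetric]
    by (subst measure_distr) (auto intro!: arg_cong[where f="measure N"])
  show ?thesis
  proof (cases "w = 0")
    case True
    then show ?thesis
      unfolding B normal_law_def using \<open>t > 0\<close> by (simp add: measure_return)
  next
    case False
    then have w: "w > 0" using \<open>0 \<le> w\<close> by simp
    interpret L: prob_space "normal_law 0 w"
      unfolding law[symmetric] by (rule N.prob_space_distr) simp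
    have [measurable_cong]: "sets (normal_law 0 w) = sets borel"
      unfolding law[symmetric] by simp
    have sp: "space (normal_law 0 w) = UNIV"
      unfolding law[symmetric] by simp
    let ?g = "\<lambda>x. ennreal (exp (- (- (3/4) * x\<^sup>2 / (2 * w))))"
    let ?c = "exp (- (3 * t\<^sup>2 / (8 * w)))"
    have "emeasure (normal_law 0 w) ?B \<le>
        emeasure (normal_law 0 w) {x \<in> UNIV. 1 \<le> ennreal ?c * ?g x}"
    proof (rule emeasure_mono)
      have "t\<^sup>2 \<le> x\<^sup>2" if "\<bar>x\<bar> > t" for x
        using that \<open>t > 0\<close> by (metis abs_le_square_iff abs_of_pos less_imp_le)
      then show "?B \<subseteq> {x \<in> UNIV. 1 \<le> ennreal ?c * ?g x}"
        using w by (auto simp: ennreal_mult[symmetric] mult_exp_exp field_simps)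
    qed measurable
    also have "\<dots> \<le> ennreal ?c * (\<integral>\<^sup>+x. ?g x * indicator UNIV x \<partial>normal_law 0 w)"
      using nn_integral_Markov_inequality[of ?g UNIV "normal_law 0 w" "ennreal ?c"]
      by measurable
    also have "(\<integral>\<^sup>+x. ?g x * indicator UNIV x \<partial>normal_law 0 w) = ennreal 2"
      using nn_integral_normal_law_exp_square[OF w, of "-3/4"] by (simp add: real_sqrt_divide)
    also have "ennreal ?c * ennreal 2 = ennreal (2 * ?c)"
      by (subst ennreal_mult[symmetric]) (simp_all add: mult.commute)
    finally have "measure (normal_law 0 w) ?B \<le> 2 * ?c"
      by (simp add: L.emeasure_eq_measure)
    also have "\<dots> \<le> 2 * exp (- (3 * t\<^sup>2 / (8 * v)))"
      using w \<open>w \<le> v\<close> by (auto intro!: divide_left_mono mult_pos_pos)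
    finally show ?thesis unfolding B .
  qed
qed

section \<open>Maurey's empirical method\<close>

text \<open>Vectors and matrices are functions here, of which only the values at indices below
  \<open>p\<close> count; single-coordinate updates and limits then carry no dimension
  conditions.\<close>

definition bform :: "nat \<Rightarrow> (nat \<Rightarrow> nat \<Rightarrow> real) \<Rightarrow> (nat \<Rightarrow> real) \<Rightarrow> (nat \<Rightarrow> real) \<Rightarrow> real" where
  "bform p M u v = (\<Sum>i<p. u i * (\<Sum>j<p. M i j * v j))"

text \<open>Divided by \<open>d\<close>, these are the points that Maurey's method uses to
  approximate the unit l1 ball. Starting from the zero function fixes the values at indices from
  \<open>p\<close> on, which keeps the set finite.\<close>

fun signed_sums :: "nat \<Rightarrow> nat \<Rightarrow> (nat \<Rightarrow> real) set" where
  "signed_sums p 0 = {\<lambda>_. 0}"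
| "signed_sums p (Suc d) = (\<lambda>(u, j, c). u(j := u j + c)) ` (signed_sums p d \<times> {..<p} \<times> {1, -1})"

lemma finite_signed_sums: "finite (signed_sums p d)"
  by (induction d) auto

lemma card_signed_sums_le: "card (signed_sums p d) \<le> (2 * p) ^ d"
proof (induction d)
  case (Suc d)
  have "card (signed_sums p (Suc d)) \<le> card (signed_sums p d \<times> {..<p} \<times> {1, -1 :: real})"
    unfolding signed_sums.simps by (intro card_image_le) (simp add: finite_signed_sums)
  also have "\<dots> = card (signed_sums p d) * (2 * p)"
    by (simp add: card_cartesian_product)
  also have "\<dots> \<le> (2 * p) ^ Suc d"
    using Suc by simp
  finally show ?case .
qed simp

lemma bform_add_left: "bform p M (\<lambda>i. u i + v i) z = bform p M u z + bform p M v z"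
  by (simp add: bform_def distrib_right sum.distrib)

lemma bform_add_right: "bform p M u (\<lambda>i. v i + z i) = bform p M u v + bform p M u z"
  by (simp add: bform_def distrib_left sum.distrib)

lemma bform_scale_left: "bform p M (\<lambda>i. c * u i) v = c * bform p M u v"
  by (simp add: bform_def sum_distrib_left mult.assoc)

lemma bform_scale_right: "bform p M u (\<lambda>i. c * v i) = c * bform p M u v"
  by (simp add: bform_def sum_distrib_left mult.left_commute)

lemma bform_sym:
  assumes "\<And>i j. i < p \<Longrightarrow> j < p \<Longrightarrow> M i j = M j i"
  shows "bform p M u v = bform p M v u"
proof -
  have "bform p M u v = (\<Sum>i<p. \<Sum>j<p. M i j * u i * v j)"
    by (simp add: bform_def sum_distrib_left mult_ac)
  also have "\<dots> = (\<Sum>j<p. \<Sum>i<p. M i j * u i * v j)"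
    by (rule sum.swap)
  also have "\<dots> = (\<Sum>j<p. \<Sum>i<p. M j i * v j * u i)"
    by (intro sum.cong refl) (use assms in auto)
  also have "\<dots> = bform p M v u"
    by (simp add: bform_def sum_distrib_left mult_ac)
  finally show ?thesis .
qed

lemma bform_fun_upd:
  assumes sym: "\<And>i j. i < p \<Longrightarrow> j < p \<Longrightarrow> M i j = M j i" and j: "j < p"
  shows "bform p M (u(j := u j + c)) (u(j := u j + c)) =
    bform p M u u + 2 * c * (\<Sum>i<p. M j i * u i) + c\<^sup>2 * M j j"
proof -
  let ?e = "\<lambda>i. if i = j then 1 else 0::real"
  have upd: "u(j := u j + c) = (\<lambda>i. u i + c * ?e i)" by auto
  have e: "bform p M ?e v = (\<Sum>i<p. M j i * v i)" for v
  proof -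
    have "bform p M ?e v = (\<Sum>i<p. if i = j then \<Sum>k<p. M i k * v k else 0)"
      unfolding bform_def by (intro sum.cong) auto
    then show ?thesis using j by simp
  qed
  have ee: "bform p M ?e ?e = M j j"
  proof -
    have "(\<Sum>i<p. M j i * ?e i) = (\<Sum>i<p. if i = j then M j i else 0)"
      by (intro sum.cong) auto
    then show ?thesis unfolding e using j by simp
  qed
  have "bform p M (u(j := u j + c)) (u(j := u j + c)) =
      bform p M u u + c * bform p M ?e u + c * bform p M u ?e + c * (c * bform p M ?e ?e)"
    unfolding upd bform_add_left bform_add_right bform_scale_left bform_scale_right
    by (simp add: algebra_simps)
  also have "bform p M u ?e = bform p M ?e u" by (rule bform_sym[OF sym])
  finally have "bform p M (u(j := u j + c)) (u(j := u j + c)) =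
      bform p M u u + c * bform p M ?e u + c * bform p M ?e u + c * (c * bform p M ?e ?e)" .
  also have "\<dots> = bform p M u u + 2 * c * (\<Sum>i<p. M j i * u i) + c\<^sup>2 * M j j"
    unfolding e[of u] ee by (simp only: power2_eq_square)
  finally show ?thesis .
qed

text \<open>
  Drawing \<open>j\<close> with probability \<open>\<bar>x j\<bar>\<close> and \<open>c = sgn (x j)\<close>, the right-hand side is the expectation
  of the left-hand side.
\<close>

lemma exists_signed_step:
  assumes sym: "\<And>i j. i < p \<Longrightarrow> j < p \<Longrightarrow> M i j = M j i" and x: "(\<Sum>j<p. \<bar>x j\<bar>) = 1"
  shows "\<exists>j<p. \<exists>c\<in>{1, -1}. bform p M (z(j := z j + c)) (z(j := z j + c)) \<le>
    bform p M (\<lambda>i. z i + x i) (\<lambda>i. z i + x i) - bform p M x x + (\<Sum>j<p. \<bar>x j\<bar> * M j j)"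
    (is "\<exists>j<p. \<exists>c\<in>_. _ \<le> ?R")
\<comment> \<open>If every outcome exceeded its mean \<open>?R\<close>, the weighted sum of the
  positive excesses could vanish only with all weights zero, against the total weight 1.\<close>
proof (rule ccontr)
  assume *: "\<not> ?thesis"
  \<comment> \<open>At \<open>x j = 0\<close> the sign is set to 1, since \<open>sgn\<close> would
    give 0, which is not an admissible step.\<close>
  define c where "c j = (if x j \<ge> 0 then 1 else -1 :: real)" for j
  have arith: "a * (q + 2 * c * b + e * m) = a * q + 2 * ((a * c) * b) + a * (e * m)"
    for a b c e m q :: real
    by (simp add: algebra_simps)
  define g where "g j = bform p M (z(j := z j + c j)) (z(j := z j + c j))" for j
  have gt: "g j > ?R" if "j < p" for j
  proof -
    have "c j \<in> {1, -1}" by (auto simp: c_def)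
    then show ?thesis using * that unfolding g_def not_le[symmetric] by blast
  qed
  have "\<bar>x j\<bar> * g j = \<bar>x j\<bar> * bform p M z z + 2 * (x j * (\<Sum>i<p. M j i * z i)) + \<bar>x j\<bar> * M j j"
    if "j < p" for j
  proof -
    have upd: "bform p M (z(j := z j + c j)) (z(j := z j + c j)) =
        bform p M z z + 2 * c j * (\<Sum>i<p. M j i * z i) + (c j)\<^sup>2 * M j j"
      by (rule bform_fun_upd) (use sym that in auto)
    have c: "\<bar>x j\<bar> * c j = x j" "(c j)\<^sup>2 = 1" by (auto simp: c_def)
    have "\<bar>x j\<bar> * g j = \<bar>x j\<bar> * bform p M z z + 2 * ((\<bar>x j\<bar> * c j) * (\<Sum>i<p. M j i * z i)) +
        \<bar>x j\<bar> * ((c j)\<^sup>2 * M j j)"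
      unfolding g_def upd by (rule arith)
    then show ?thesis unfolding c by simp
  qed
  then have "(\<Sum>j<p. \<bar>x j\<bar> * g j) =
      (\<Sum>j<p. \<bar>x j\<bar> * bform p M z z + 2 * (x j * (\<Sum>i<p. M j i * z i)) + \<bar>x j\<bar> * M j j)"
    by simp
  also have "\<dots> = (\<Sum>j<p. \<bar>x j\<bar>) * bform p M z z + 2 * bform p M x z + (\<Sum>j<p. \<bar>x j\<bar> * M j j)"
    by (simp only: sum.distrib sum_distrib_left[symmetric] sum_distrib_right[symmetric] bform_def)
  \<comment> \<open>With total weight 1, completing the square in \<open>z + x\<close> replaces the
    cross term and costs \<open>bform p M x x\<close>.\<close>
  also have "\<dots> = ?R"
    unfolding bform_add_left bform_add_right x using bform_sym[of p M z x, OF sym] by simp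
  finally have sum_R: "(\<Sum>j<p. \<bar>x j\<bar> * g j) = ?R" .
  define R where "R = ?R"
  have gt_R: "g j - R > 0" if "j < p" for j
    using gt[OF that] unfolding R_def by simp
  have "(\<Sum>j<p. \<bar>x j\<bar> * (g j - R)) = R - (\<Sum>j<p. \<bar>x j\<bar>) * R"
    unfolding right_diff_distrib sum_subtractf sum_distrib_right[symmetric] sum_R R_def ..
  then have "(\<Sum>j<p. \<bar>x j\<bar> * (g j - R)) = 0" unfolding x by simp
  then have "\<bar>x j\<bar> * (g j - R) = 0" if "j < p" for j
    using that gt_R by (subst (asm) sum_nonneg_eq_0_iff) (auto simp: less_imp_le)
  then have "x j = 0" if "j < p" for j
    using gt_R[OF that] that by force
  then show False using x by simp
qed

text \<open>
  Derandomized: each of the \<open>d\<close> draws with mean \<open>x\<close> is replaced in turn by a value that does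
  not exceed its expectation; \<open>r * x\<close> stands for the draws not yet made.
\<close>

lemma exists_signed_sum_le:
  assumes sym: "\<And>i j. i < p \<Longrightarrow> j < p \<Longrightarrow> M i j = M j i" and x: "(\<Sum>j<p. \<bar>x j\<bar>) = 1"
  shows "\<exists>u\<in>signed_sums p d. bform p M (\<lambda>i. u i + r * x i) (\<lambda>i. u i + r * x i) \<le>
    (r + real d)\<^sup>2 * bform p M x x + real d * ((\<Sum>j<p. \<bar>x j\<bar> * M j j) - bform p M x x)"
proof (induction d arbitrary: r)
  case 0
  then show ?case
    by (simp add: bform_scale_left bform_scale_right power2_eq_square)
next
  case (Suc d)
  let ?V = "(\<Sum>j<p. \<bar>x j\<bar> * M j j) - bform p M x x"
  \<comment> \<open>The hypothesis is used at \<open>r + 1\<close>: one draw is still kept at its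
    mean \<open>x\<close>, and \<open>exists_signed_step\<close> then rounds this draw.\<close>
  obtain u where u: "u \<in> signed_sums p d"
    "bform p M (\<lambda>i. u i + (r + 1) * x i) (\<lambda>i. u i + (r + 1) * x i) \<le>
      (r + 1 + real d)\<^sup>2 * bform p M x x + real d * ?V"
    using Suc by blast
  let ?z = "\<lambda>i. u i + r * x i"
  obtain j c where jc: "j < p" "c \<in> {1, -1}"
    "bform p M (?z(j := ?z j + c)) (?z(j := ?z j + c)) \<le>
      bform p M (\<lambda>i. ?z i + x i) (\<lambda>i. ?z i + x i) - bform p M x x + (\<Sum>j<p. \<bar>x j\<bar> * M j j)"
    using exists_signed_step[of p M x ?z, OF sym x] by blast
  let ?u = "u(j := u j + c)"
  have 1: "?z(j := ?z j + c) = (\<lambda>i. ?u i + r * x i)" by auto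
  have 2: "(\<lambda>i. ?z i + x i) = (\<lambda>i. u i + (r + 1) * x i)" by (auto simp: algebra_simps)
  have "?u \<in> signed_sums p (Suc d)"
    using u(1) jc(1,2) by force
  moreover have "bform p M (\<lambda>i. ?u i + r * x i) (\<lambda>i. ?u i + r * x i) \<le>
      (r + real (Suc d))\<^sup>2 * bform p M x x + real (Suc d) * ?V"
    using jc(3) u(2) unfolding 1 2 by (simp add: algebra_simps)
  ultimately show ?case by blast
qed

text \<open>For \<open>y\<close> of l1 norm 1, rounding with r = 0 gives a signed sum whose form is
  at most d ((d - 1) y^T M y + b). As this form is nonnegative, y^T M y is at least -b / (d - 1),
  and homogeneity gives the general case. The form \<open>M\<close> may be indefinite, as it is in
  the application.\<close>

lemma bform_ge_of_signed_sums:
  assumes sym: "\<And>i j. i < p \<Longrightarrow> j < p \<Longrightarrow> M i j = M j i"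
    and nonneg: "\<And>u. u \<in> signed_sums p d \<Longrightarrow> bform p M u u \<ge> 0"
    and diag: "\<And>j. j < p \<Longrightarrow> M j j \<le> b" and d: "d \<ge> 2"
  shows "bform p M x x \<ge> - (b * (\<Sum>j<p. \<bar>x j\<bar>)\<^sup>2 / (real d - 1))"
proof (cases "(\<Sum>j<p. \<bar>x j\<bar>) = 0")
  case True
  then have "x j = 0" if "j < p" for j
    using that by (simp add: sum_nonneg_eq_0_iff)
  then have "bform p M x x = 0" by (simp add: bform_def)
  then show ?thesis using True by simp
next
  case False
  define L where "L = (\<Sum>j<p. \<bar>x j\<bar>)"
  have L: "L > 0" using False by (simp add: L_def order_less_le sum_nonneg)
  define y where "y i = (1 / L) * x i" for i
  have y1: "(\<Sum>j<p. \<bar>y j\<bar>) = 1"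
    using L by (simp add: y_def abs_mult sum_divide_distrib[symmetric] L_def[symmetric])
  have xy: "bform p M x x = L\<^sup>2 * bform p M y y"
    using L by (simp add: y_def[abs_def] bform_scale_left bform_scale_right power2_eq_square
        bform_scale_left[of _ _ "1/L", simplified] bform_scale_right[of _ _ _ "1/L", simplified])
  obtain u where u: "u \<in> signed_sums p d"
    "bform p M u u \<le> (real d)\<^sup>2 * bform p M y y + real d * ((\<Sum>j<p. \<bar>y j\<bar> * M j j) - bform p M y y)"
    using exists_signed_sum_le[of p M y d 0, OF sym y1] by auto
  have "(\<Sum>j<p. \<bar>y j\<bar> * M j j) \<le> (\<Sum>j<p. \<bar>y j\<bar> * b)"
    using diag by (intro sum_mono mult_left_mono) auto
  also have "\<dots> = b" using y1 by (simp add: sum_distrib_right[symmetric])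
  finally have V: "(\<Sum>j<p. \<bar>y j\<bar> * M j j) \<le> b" .
  have "0 \<le> real d * ((real d - 1) * bform p M y y + (\<Sum>j<p. \<bar>y j\<bar> * M j j))"
    using u(2) nonneg[OF u(1)] by (simp add: algebra_simps power2_eq_square)
  then have "0 \<le> (real d - 1) * bform p M y y + (\<Sum>j<p. \<bar>y j\<bar> * M j j)"
    using d by (simp add: zero_le_mult_iff)
  then have "- b \<le> (real d - 1) * bform p M y y" using V by linarith
  then have "- b / (real d - 1) \<le> bform p M y y"
    using d by (simp add: divide_simps mult.commute)
  then have "L\<^sup>2 * (- b / (real d - 1)) \<le> L\<^sup>2 * bform p M y y"
    by (intro mult_left_mono) auto
  then show ?thesis unfolding xy L_def[symmetric] by (simp add: mult.commute)
qed

section \<open>Quadratic forms and the smallest singular value\<close>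

lemma bform_diff:
  "bform p (\<lambda>i j. M i j - N i j) u v = bform p M u v - bform p N u v"
  by (simp add: bform_def left_diff_distrib right_diff_distrib sum_subtractf)

lemma bform_scalar: "bform p (\<lambda>i j. if i = j then c else 0) u v = c * (\<Sum>i<p. u i * v i)"
proof -
  have "(\<Sum>j<p. (if i = j then c else 0) * v j) = c * v i" if "i < p" for i
  proof -
    have "(\<Sum>j<p. (if i = j then c else 0) * v j) = (\<Sum>j<p. if i = j then c * v j else 0)"
      by (intro sum.cong) auto
    then show ?thesis using that by simp
  qed
  then show ?thesis by (simp add: bform_def sum_distrib_left mult.left_commute)
qed

text \<open>A nonnegative quadratic form has a minimum at each of its zeros, so its derivative
  vanishes there in every direction. This turns a minimiser of the Rayleigh quotient into an
  eigenvector.\<close>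

lemma bform_psd_null:
  assumes sym: "\<And>i j. i < p \<Longrightarrow> j < p \<Longrightarrow> M i j = M j i"
    and psd: "\<And>u. bform p M u u \<ge> 0" and null: "bform p M f f = 0"
  shows "bform p M g f = 0"
proof (rule ccontr)
  assume "bform p M g f \<noteq> 0"
  define b c where "b = bform p M g f" and "c = bform p M g g"
  have b: "b \<noteq> 0" using \<open>bform p M g f \<noteq> 0\<close> by (simp add: b_def)
  have c: "c \<ge> 0" unfolding c_def by (rule psd)
  (* any step t with sign opposite to b and 0 < \<bar>t\<bar> c < 2 \<bar>b\<bar> makes 2tb + t^2 c negative *)
  define t where "t = - b / (c + 1)"
  have "bform p M (\<lambda>i. f i + t * g i) (\<lambda>i. f i + t * g i) = 2 * t * b + t\<^sup>2 * c"
    unfolding bform_add_left bform_add_right bform_scale_left bform_scale_right null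
    using bform_sym[of p M f g, OF sym] by (simp add: b_def c_def power2_eq_square)
  also have "\<dots> = - (b\<^sup>2 * (c + 2) / (c + 1)\<^sup>2)"
    using c by (simp add: t_def divide_simps power2_eq_square) (simp add: algebra_simps)
  also have "\<dots> < 0" using b c by simp
  finally show False using psd[of "\<lambda>i. f i + t * g i"] by simp
qed

lemma exists_sphere_minimum_bform:
  assumes "p > 0"
  shows "\<exists>f. (\<Sum>i<p. (f i)\<^sup>2) = 1 \<and> (\<forall>g. (\<Sum>i<p. (g i)\<^sup>2) = 1 \<longrightarrow> bform p M f f \<le> bform p M g g)"
proof -
  \<comment> \<open>Coordinates from \<open>p\<close> on are pinned to 0, so that Tychonoff's
    theorem makes the box compact in the product topology on all functions.\<close>
  define B where "B = (\<Pi>\<^sub>E i\<in>(UNIV::nat set). if i < p then {-1..1} else {0::real})"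
  define K where "K = B \<inter> {f. (\<Sum>i<p. (f i)\<^sup>2) = 1}"
  have "compactin (product_topology (\<lambda>i. euclidean) UNIV) B"
    unfolding B_def by (subst compactin_PiE) auto
  then have "compact B" by (simp add: euclidean_product_topology)
  moreover have "closed {f :: nat \<Rightarrow> real. (\<Sum>i<p. (f i)\<^sup>2) = 1}"
    by (intro closed_Collect_eq continuous_intros continuous_on_product_coordinates)
  ultimately have "compact K" unfolding K_def by (rule compact_Int_closed)
  moreover have "(\<lambda>i. if i = 0 then 1 else 0) \<in> K"
    using assms by (auto simp: K_def B_def if_distrib[of "\<lambda>x. x\<^sup>2"] cong: if_cong)
  then have "K \<noteq> {}" by blast
  moreover have "continuous_on K (\<lambda>f. bform p M f f)"
    unfolding bform_def by (intro continuous_intros continuous_on_product_coordinates[THEN continuous_on_subset]) auto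
  ultimately obtain f where f: "f \<in> K" "\<forall>g\<in>K. bform p M f f \<le> bform p M g g"
    by (rule continuous_attains_inf[THEN bexE]) auto
  have "bform p M f f \<le> bform p M g g" if g: "(\<Sum>i<p. (g i)\<^sup>2) = 1" for g
  proof -
    \<comment> \<open>Truncation moves a competitor into the box and changes neither the constraint
      nor the form.\<close>
    define g' where "g' i = (if i < p then g i else 0)" for i
    have "(g i)\<^sup>2 \<le> 1" if "i < p" for i
      using member_le_sum[of i "{..<p}" "\<lambda>i. (g i)\<^sup>2"] that g by simp
    then have "g' \<in> K"
      using g by (auto simp: K_def B_def g'_def abs_square_le_1 abs_le_iff)
    then have "bform p M f f \<le> bform p M g' g'" using f by blast
    also have "\<dots> = bform p M g g" by (simp add: bform_def g'_def)
    finally show ?thesis .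
  qed
  then show ?thesis using f(1) unfolding K_def by blast
qed

text \<open>Let \<mu> be the minimum of the form on the sphere, attained at \<open>f\<close>. Then
  \<open>M\<close> minus \<mu> times the identity is nonnegative and vanishes at \<open>f\<close>,
  so by \<open>bform_psd_null\<close> it annihilates \<open>f\<close>; testing against unit vectors
  reads off the eigenvalue equation.\<close>

lemma bform_ge_min_eigenvalue:
  assumes sym: "\<And>i j. i < p \<Longrightarrow> j < p \<Longrightarrow> M i j = M j i" and p: "p > 0"
  shows "\<exists>\<mu> f. (\<Sum>i<p. (f i)\<^sup>2) = 1 \<and> (\<forall>i<p. (\<Sum>j<p. M i j * f j) = \<mu> * f i) \<and>
    (\<forall>v. \<mu> * (\<Sum>i<p. (v i)\<^sup>2) \<le> bform p M v v)"
proof -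
  obtain f where f: "(\<Sum>i<p. (f i)\<^sup>2) = 1"
    "\<And>g. (\<Sum>i<p. (g i)\<^sup>2) = 1 \<Longrightarrow> bform p M f f \<le> bform p M g g"
    using exists_sphere_minimum_bform[OF p] by blast
  define \<mu> where "\<mu> = bform p M f f"
  have ge: "bform p M v v \<ge> \<mu> * (\<Sum>i<p. (v i)\<^sup>2)" for v
  proof (cases "(\<Sum>i<p. (v i)\<^sup>2) = 0")
    case True
    then have "v i = 0" if "i < p" for i using that by (simp add: sum_nonneg_eq_0_iff)
    then show ?thesis by (simp add: bform_def)
  next
    case False
    define q where "q = (\<Sum>i<p. (v i)\<^sup>2)"
    have q: "q > 0" using False by (simp add: q_def order_less_le sum_nonneg)
    have "(\<Sum>i<p. (1 / sqrt q * v i)\<^sup>2) = 1"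
      using q by (simp add: power_mult_distrib power_divide sum_divide_distrib[symmetric] q_def[symmetric])
    from f(2)[OF this] have "\<mu> \<le> bform p M v v / q"
      using q by (simp only: bform_scale_left bform_scale_right \<mu>_def) (simp add: divide_simps)
    then show ?thesis using q by (simp add: q_def[symmetric] pos_le_divide_eq)
  qed
  define N where "N i j = M i j - (if i = j then \<mu> else 0)" for i j
  have N: "bform p N u v = bform p M u v - \<mu> * (\<Sum>i<p. u i * v i)" for u v
    unfolding N_def[abs_def] bform_diff bform_scalar ..
  have symN: "\<And>i j. i < p \<Longrightarrow> j < p \<Longrightarrow> N i j = N j i" using sym by (auto simp: N_def)
  have psd: "bform p N u u \<ge> 0" for u
    using ge[of u] unfolding N by (simp add: power2_eq_square)
  have null: "bform p N f f = 0"
    unfolding N using f(1) by (simp add: \<mu>_def power2_eq_square)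
  have "(\<Sum>j<p. M i j * f j) = \<mu> * f i" if "i < p" for i
  proof -
    let ?e = "\<lambda>k. if k = i then 1 else 0::real"
    have d: "(\<Sum>k<p. ?e k * h k) = h i" for h :: "nat \<Rightarrow> real"
    proof -
      have "(\<Sum>k<p. ?e k * h k) = (\<Sum>k<p. if k = i then h k else 0)"
        by (intro sum.cong) auto
      then show ?thesis using that by simp
    qed
    have "bform p N ?e f = 0"
        using bform_psd_null[of p N f ?e] symN psd null by blast
    then show ?thesis unfolding N unfolding bform_def d by simp
  qed
  then show ?thesis using f(1) ge by blast
qed

text \<open>The minimum \<mu> of the form on the sphere is an eigenvalue of \<open>S\<close>, so its
  square lies in the spectrum of S^T S. Semidefiniteness gives \<mu> \<ge> 0, so the root of this
  square is \<mu> itself and bounds the smallest singular value from above.\<close>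

lemma bform_ge_smallest_singular_value:
  assumes S: "S \<in> carrier_mat p p" and sym: "transpose_mat S = S" and p: "p > 0"
    and psd: "\<And>u. u \<in> carrier_vec p \<Longrightarrow> 0 \<le> u \<bullet> (S *\<^sub>v u)"
  shows "bform p (\<lambda>i j. S $$ (i, j)) v v \<ge> smallest_singular_value S * (\<Sum>i<p. (v i)\<^sup>2)"
proof -
  let ?M = "\<lambda>i j. S $$ (i, j)"
  have symM: "?M i j = ?M j i" if "i < p" "j < p" for i j
    using that S arg_cong[OF sym, of "\<lambda>T. T $$ (i, j)"] by auto
  have "\<exists>\<mu> f. (\<Sum>i<p. (f i)\<^sup>2) = 1 \<and> (\<forall>i<p. (\<Sum>j<p. ?M i j * f j) = \<mu> * f i) \<and>
      (\<forall>v. \<mu> * (\<Sum>i<p. (v i)\<^sup>2) \<le> bform p ?M v v)"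
    by (rule bform_ge_min_eigenvalue) (use symM p in auto)
  then obtain \<mu> f where f: "(\<Sum>i<p. (f i)\<^sup>2) = 1" "\<forall>i<p. (\<Sum>j<p. ?M i j * f j) = \<mu> * f i"
    "\<forall>v. \<mu> * (\<Sum>i<p. (v i)\<^sup>2) \<le> bform p ?M v v"
    by (elim exE conjE)
  let ?w = "vec p f"
  have Sw: "S *\<^sub>v ?w = \<mu> \<cdot>\<^sub>v ?w"
    using S f(2) by (intro eq_vecI) (auto simp: scalar_prod_def atLeast0LessThan)
  have "?w \<bullet> (S *\<^sub>v ?w) = \<mu> * (\<Sum>i<p. (f i)\<^sup>2)"
    unfolding Sw by (simp add: scalar_prod_def atLeast0LessThan sum_distrib_left power2_eq_square mult_ac)
  then have mu: "\<mu> \<ge> 0" using psd[of ?w] f(1) by simp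
  have "?w \<noteq> 0\<^sub>v p"
  proof
    assume "?w = 0\<^sub>v p"
    then have "f i = 0" if "i < p" for i using that by (metis index_vec index_zero_vec(1))
    then show False using f(1) by simp
  qed
  moreover have "(transpose_mat S * S) *\<^sub>v ?w = \<mu>\<^sup>2 \<cdot>\<^sub>v ?w"
    unfolding sym using S
    by (subst assoc_mult_mat_vec[of _ p p _ p]) (auto simp: Sw mult_mat_vec power2_eq_square smult_smult_assoc)
  ultimately have "\<mu>\<^sup>2 \<in> spectrum (transpose_mat S * S)"
    using S by (auto simp: spectrum_def eigenvalue_def eigenvector_def intro!: exI[of _ ?w])
  moreover have "finite (spectrum (transpose_mat S * S))"
    using card_finite_spectrum(1)[of "transpose_mat S * S" p] S by simp
  ultimately have "smallest_singular_value S \<le> sqrt (\<mu>\<^sup>2)"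
    unfolding smallest_singular_value_def by (intro Min_le imageI finite_imageI)
  then have "smallest_singular_value S * (\<Sum>i<p. (v i)\<^sup>2) \<le> \<mu> * (\<Sum>i<p. (v i)\<^sup>2)"
    using mu by (intro mult_right_mono) (auto intro: sum_nonneg)
  then show ?thesis using f(3)[rule_format, of v] by linarith
qed

section \<open>The random design\<close>

lemma bform_unit:
  assumes "j < p"
  shows "bform p M (\<lambda>i. if i = j then 1 else 0) (\<lambda>i. if i = j then 1 else 0) = M j j"
  using assms unfolding bform_def
  by (simp add: if_distrib[of "\<lambda>x. x * _"] if_distrib[of "\<lambda>x. _ * x"] cong: if_cong)

lemma multivariate_normal_linear:
  fixes u :: "nat \<Rightarrow> real"
  assumes "multivariate_normal p (0\<^sub>v p) S N"
  shows "(\<lambda>z. \<Sum>j<p. u j * z j) \<in> borel_measurable N"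
    and "distr N borel (\<lambda>z. \<Sum>j<p. u j * z j) = normal_law 0 (bform p (\<lambda>i j. S $$ (i, j)) u u)"
    and "0 \<le> bform p (\<lambda>i j. S $$ (i, j)) u u"
proof -
  have N: "sets N = sets (PiM {..<p} (\<lambda>_. borel))" and S: "S \<in> carrier_mat p p"
    using assms by (auto simp: multivariate_normal_def)
  have "(\<lambda>z. z j) \<in> borel_measurable N" if "j < p" for j
    unfolding measurable_cong_sets[OF N refl] using that by simp
  then show "(\<lambda>z. \<Sum>j<p. u j * z j) \<in> borel_measurable N"
    by (intro borel_measurable_sum borel_measurable_times) auto
  have 1: "vec p u \<bullet> vec p z = (\<Sum>j<p. u j * z j)" for z
    by (simp add: scalar_prod_def atLeast0LessThan)
  have 2: "vec p u \<bullet> (S *\<^sub>v vec p u) = bform p (\<lambda>i j. S $$ (i, j)) u u"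
    using S by (simp add: scalar_prod_def bform_def atLeast0LessThan)
  have u: "vec p u \<in> carrier_vec p" by simp
  show "distr N borel (\<lambda>z. \<Sum>j<p. u j * z j) = normal_law 0 (bform p (\<lambda>i j. S $$ (i, j)) u u)"
    using assms u unfolding multivariate_normal_def 1[symmetric] 2[symmetric]
    by (metis scalar_prod_right_zero)
  show "0 \<le> bform p (\<lambda>i j. S $$ (i, j)) u u"
    using assms u unfolding multivariate_normal_def 2[symmetric] by blast
qed

lemma bform_gram:
  "bform p (\<lambda>i j. \<Sum>k<n. B k i * B k j) u u = (\<Sum>k<n. (\<Sum>j<p. B k j * u j)\<^sup>2)"
proof -
  have "(\<Sum>k<n. (\<Sum>j<p. B k j * u j)\<^sup>2) = (\<Sum>k<n. \<Sum>i<p. \<Sum>j<p. u i * (B k i * B k j * u j))"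
    by (simp add: power2_eq_square sum_product mult_ac)
  also have "\<dots> = (\<Sum>i<p. \<Sum>k<n. \<Sum>j<p. u i * (B k i * B k j * u j))"
    by (rule sum.swap)
  also have "\<dots> = (\<Sum>i<p. \<Sum>j<p. \<Sum>k<n. u i * (B k i * B k j * u j))"
    by (intro sum.cong refl sum.swap)
  also have "\<dots> = bform p (\<lambda>i j. \<Sum>k<n. B k i * B k j) u u"
    by (simp add: bform_def sum_distrib_left sum_distrib_right mult_ac)
  finally show ?thesis ..
qed

text \<open>Maurey's transfer is applied to the Gram matrix of \<open>B\<close> minus S/4, which is
  nonnegative on signed sums by \<open>T\<close> and has diagonal at most \<open>b\<close>. Of the
  l/4 that S/4 contributes, the transfer error takes at most l/8 when the l1 norm is controlled by
  \<open>R\<close>; the other half remains.\<close>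

lemma restricted_eigenvalue_of_signed_sums:
  fixes B S :: "nat \<Rightarrow> nat \<Rightarrow> real" and n p d :: nat
  assumes sym: "\<And>i j. i < p \<Longrightarrow> j < p \<Longrightarrow> S i j = S j i" and diag: "\<And>j. j < p \<Longrightarrow> S j j \<ge> 0"
    and S: "\<And>v. l * (\<Sum>j<p. (v j)\<^sup>2) \<le> bform p S v v"
    and T: "\<And>u. u \<in> signed_sums p d \<Longrightarrow> bform p S u u / 4 \<le> (\<Sum>i<n. (\<Sum>j<p. B i j * u j)\<^sup>2)"
    and col: "\<And>j. j < p \<Longrightarrow> (\<Sum>i<n. (B i j)\<^sup>2) \<le> b"
    and d: "d \<ge> 2" and b: "b \<ge> 0" and R: "b * R \<le> l / 8 * (real d - 1)"
    and v: "(\<Sum>j<p. \<bar>v j\<bar>)\<^sup>2 \<le> R * (\<Sum>j<p. (v j)\<^sup>2)"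
  shows "l / 8 * (\<Sum>j<p. (v j)\<^sup>2) \<le> (\<Sum>i<n. (\<Sum>j<p. B i j * v j)\<^sup>2)"
proof -
  define M where "M i j = (\<Sum>k<n. B k i * B k j) - S i j / 4" for i j
  have M: "bform p M u u = (\<Sum>i<n. (\<Sum>j<p. B i j * u j)\<^sup>2) - bform p S u u / 4" for u
  proof -
    have "bform p (\<lambda>i j. S i j / 4) u u = bform p S u u / 4"
      by (simp add: bform_def sum_divide_distrib[symmetric])
    then show ?thesis unfolding M_def[abs_def] bform_diff bform_gram by simp
  qed
  have "bform p M v v \<ge> - (b * (\<Sum>j<p. \<bar>v j\<bar>)\<^sup>2 / (real d - 1))"
  proof (rule bform_ge_of_signed_sums[OF _ _ _ d])
    show "M i j = M j i" if "i < p" "j < p" for i j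
      using sym[OF that] by (simp add: M_def mult.commute)
    show "bform p M u u \<ge> 0" if "u \<in> signed_sums p d" for u
      using T[OF that] by (simp add: M)
    show "M j j \<le> b" if "j < p" for j
      using col[OF that] diag[OF that] by (simp add: M_def power2_eq_square)
  qed
  moreover have "b * (\<Sum>j<p. \<bar>v j\<bar>)\<^sup>2 / (real d - 1) \<le> l / 8 * (\<Sum>j<p. (v j)\<^sup>2)"
  proof -
    have "b * (\<Sum>j<p. \<bar>v j\<bar>)\<^sup>2 \<le> b * R * (\<Sum>j<p. (v j)\<^sup>2)"
      using mult_left_mono[OF v b] by (simp add: mult.assoc)
    also have "\<dots> \<le> l / 8 * (real d - 1) * (\<Sum>j<p. (v j)\<^sup>2)"
      using R by (intro mult_right_mono) (auto intro: sum_nonneg)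
    finally show ?thesis using d by (simp add: divide_simps mult_ac)
  qed
  ultimately show ?thesis using S[of v] unfolding M by linarith
qed

section \<open>Probability of the good event for design and noise\<close>

lemma measure_pair_fst:
  assumes "prob_space M" "prob_space N" "A \<in> sets M"
  shows "measure (M \<Otimes>\<^sub>M N) {\<omega> \<in> space (M \<Otimes>\<^sub>M N). fst \<omega> \<in> A} = measure M A"
proof -
  interpret M: prob_space M by fact
  interpret N: prob_space N by fact
  have "{\<omega> \<in> space (M \<Otimes>\<^sub>M N). fst \<omega> \<in> A} = A \<times> space N"
    using sets.sets_into_space[OF assms(3)] by (auto simp: space_pair_measure)
  then have "emeasure (M \<Otimes>\<^sub>M N) {\<omega> \<in> space (M \<Otimes>\<^sub>M N). fst \<omega> \<in> A} = emeasure M A"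
    using assms(3) by (simp add: N.emeasure_pair_measure_Times N.emeasure_space_1)
  then show ?thesis by (simp add: measure_def)
qed

text \<open>A union bound over three kinds of failure: a signed sum is shrunk too much
  (\<open>A\<close>), a column is too long (\<open>D\<close>), or a column of admissible length
  correlates with the noise (\<open>F\<close>). The last is estimated conditionally on the
  design.\<close>

lemma sample_law_good_event:
  fixes n p :: nat and t \<rho> \<sigma> :: real and T :: "(nat \<Rightarrow> real) set" and S :: "real mat"
  assumes Na: "multivariate_normal p (0\<^sub>v p) S Na"
    and Ne: "multivariate_normal n (0\<^sub>v n) (\<sigma>\<^sup>2 \<cdot>\<^sub>m 1\<^sub>m n) Ne"
    and n: "n \<ge> 1" and pos: "\<sigma> > 0" "\<rho> > 0" "t > 0" and T: "finite T"
    and diag: "\<And>j. j < p \<Longrightarrow> 0 < S $$ (j, j)" "\<And>j. j < p \<Longrightarrow> S $$ (j, j) \<le> \<rho>"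
  shows "\<exists>E\<in>sets (sample_law n Na Ne).
    measure (sample_law n Na Ne) E \<ge> 1 - real (card T) * exp (- real n / 4) - real p * exp (- real n)
        - real p * (2 * exp (- (3 * t\<^sup>2 / (8 * (5 * \<rho> * \<sigma>\<^sup>2))))) \<and>
    (\<forall>(a, e)\<in>E.
      (\<forall>u\<in>T. bform p (\<lambda>i j. S $$ (i, j)) u u / 4 \<le> (\<Sum>i<n. (\<Sum>j<p. a i j / sqrt (real n) * u j)\<^sup>2)) \<and>
      (\<forall>j<p. (\<Sum>i<n. (a i j / sqrt (real n))\<^sup>2) \<le> 5 * \<rho>) \<and>
      (\<forall>j<p. \<bar>\<Sum>i<n. a i j / sqrt (real n) * e i\<bar> \<le> t))"
proof -
  define P where "P = (\<Pi>\<^sub>M i\<in>{..<n}. Na)"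
  define W where "W = P \<Otimes>\<^sub>M Ne"
  have W: "sample_law n Na Ne = W" by (simp add: sample_law_def W_def P_def)
  have prob: "prob_space Na" "prob_space Ne" and sets: "sets Na = sets (PiM {..<p} (\<lambda>_. borel))"
      "sets Ne = sets (PiM {..<n} (\<lambda>_. borel))"
    using Na Ne by (auto simp: multivariate_normal_def)
  interpret Na: prob_space Na by fact
  interpret Ne: prob_space Ne by fact
  interpret PP: product_prob_space "\<lambda>i. Na" "{..<n}" by unfold_locales
  have P: "prob_space P" unfolding P_def by (rule PP.prob_space_axioms)
  interpret P: prob_space P by fact
  interpret pair: pair_prob_space P Ne by unfold_locales
  have W_prob: "prob_space W" unfolding W_def by (rule pair.prob_space_axioms)
  interpret W: prob_space W by fact
  have coord: "(\<lambda>z. z j) \<in> borel_measurable Na" if "j < p" for j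
    unfolding measurable_cong_sets[OF sets(1) refl] using that by simp
  have coord_e: "(\<lambda>z. z j) \<in> borel_measurable Ne" if "j < n" for j
    unfolding measurable_cong_sets[OF sets(2) refl] using that by simp
  have aP[measurable]: "(\<lambda>a. a i j) \<in> borel_measurable P" if "i < n" "j < p" for i j
  proof -
    have "(\<lambda>a. a i) \<in> P \<rightarrow>\<^sub>M Na"
      unfolding P_def by (rule measurable_component_singleton) (use that in simp)
    then show ?thesis by (rule measurable_compose) (rule coord[OF that(2)])
  qed
  have aW[measurable]: "(\<lambda>\<omega>. fst \<omega> i j) \<in> borel_measurable W" if "i < n" "j < p" for i j
    unfolding W_def by (rule measurable_compose[OF measurable_fst aP[OF that]])
  have eW[measurable]: "(\<lambda>\<omega>. snd \<omega> i) \<in> borel_measurable W" if "i < n" for i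
    unfolding W_def by (rule measurable_compose[OF measurable_snd coord_e[OF that]])
  let ?S = "\<lambda>i j. S $$ (i, j)"
  \<comment> \<open>The strict inequality makes the event empty when the form vanishes at
    \<open>u\<close>, where the chi-square bound does not apply.\<close>
  define A where "A u = {a \<in> space P. (\<Sum>i<n. (\<Sum>j<p. u j * a i j)\<^sup>2) < real n * bform p ?S u u / 4}" for u
  define D where "D j = {a \<in> space P. (\<Sum>i<n. (a i j)\<^sup>2) > 5 * real n * \<rho>}" for j
  \<comment> \<open>The column bound is part of the event, so that for each fixed design the noise
    correlation is either excluded or has variance at most
    \<open>5 * \<rho> * \<sigma>\<^sup>2\<close>.\<close>
  define F where "F j = {\<omega> \<in> space W. (\<Sum>i<n. (fst \<omega> i j)\<^sup>2) \<le> 5 * real n * \<rho> \<and>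
    \<bar>\<Sum>i<n. fst \<omega> i j / sqrt (real n) * snd \<omega> i\<bar> > t}" for j
  have A_sets: "A u \<in> sets P" for u
  proof -
    have [measurable]: "(\<lambda>a. \<Sum>i<n. (\<Sum>j<p. u j * a i j)\<^sup>2) \<in> borel_measurable P"
      by (intro borel_measurable_sum borel_measurable_power borel_measurable_times) (auto intro: aP)
    show ?thesis unfolding A_def by measurable
  qed
  have D_sets: "D j \<in> sets P" if "j < p" for j
  proof -
    have [measurable]: "(\<lambda>a. \<Sum>i<n. (a i j)\<^sup>2) \<in> borel_measurable P"
      using that by (intro borel_measurable_sum borel_measurable_power) (auto intro: aP)
    show ?thesis unfolding D_def by measurable
  qed
  have F_sets: "F j \<in> sets W" if "j < p" for j
  proof -
    have [measurable]: "(\<lambda>\<omega>. \<Sum>i<n. (fst \<omega> i j)\<^sup>2) \<in> borel_measurable W"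
      using that by (intro borel_measurable_sum borel_measurable_power) (auto intro: aW)
    have [measurable]: "(\<lambda>\<omega>. \<Sum>i<n. fst \<omega> i j / sqrt (real n) * snd \<omega> i) \<in> borel_measurable W"
      using that by (intro borel_measurable_sum borel_measurable_times borel_measurable_divide)
        (auto intro: aW eW)
    show ?thesis unfolding F_def by measurable
  qed
  have A_meas: "measure P (A u) \<le> exp (- real n / 4)" for u
  proof (cases "bform p ?S u u = 0")
    case True
    then have "A u = {}" by (auto simp: A_def not_less sum_nonneg)
    then show ?thesis by simp
  next
    case False
    then have "bform p ?S u u > 0" using multivariate_normal_linear(3)[OF Na, of u] by simp
    then show ?thesis
      unfolding A_def P_def
      by (intro chi_square_lower_tail[OF prob(1) multivariate_normal_linear(1,2)[OF Na]])
  qed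
  have D_meas: "measure P (D j) \<le> exp (- real n)" if j: "j < p" for j
  proof -
    let ?e = "\<lambda>i. if i = j then 1 else 0 :: real"
    let ?D = "{a \<in> space P. (\<Sum>i<n. (\<Sum>k<p. ?e k * a i k)\<^sup>2) > 5 * real n * bform p ?S ?e ?e}"
    have e: "(\<Sum>k<p. ?e k * z k) = z j" for z :: "nat \<Rightarrow> real"
      using j by (simp add: if_distrib[of "\<lambda>x. x * _"] cong: if_cong)
    have S: "bform p ?S ?e ?e = S $$ (j, j)" by (rule bform_unit[OF j])
    have "?D \<in> sets P"
    proof -
      have [measurable]: "(\<lambda>a. \<Sum>i<n. (a i j)\<^sup>2) \<in> borel_measurable P"
        using that by (intro borel_measurable_sum borel_measurable_power) (auto intro: aP)
      show ?thesis unfolding e by measurable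
    qed
    \<comment> \<open>\<open>D j\<close> has the threshold \<rho>, the chi-square bound the actual
      variance \<open>S $$ (j, j)\<close>, which is at most \<rho>.\<close>
    moreover have "D j \<subseteq> ?D"
    proof -
      have "5 * real n * S $$ (j, j) \<le> 5 * real n * \<rho>"
        using diag(2)[OF j] by (intro mult_left_mono) auto
      then show ?thesis unfolding D_def e S by auto
    qed
    ultimately have "measure P (D j) \<le> measure P ?D" by (rule P.finite_measure_mono[rotated])
    also have "\<dots> \<le> exp (- real n)"
      unfolding P_def
      by (rule chi_square_upper_tail[OF prob(1) multivariate_normal_linear(1,2)[OF Na]])
        (use S diag(1)[OF j] in simp)
    finally show ?thesis .
  qed
  let ?f = "2 * exp (- (3 * t\<^sup>2 / (8 * (5 * \<rho> * \<sigma>\<^sup>2))))"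
  have F_meas: "measure W (F j) \<le> ?f" if j: "j < p" for j
  proof -
    \<comment> \<open>Independence enters as Fubini: the noise tail is bounded uniformly over slices
      at fixed \<open>a\<close> and then integrated over the design.\<close>
    have sec: "emeasure Ne (Pair a -` F j) \<le> ennreal ?f" for a
    proof (cases "a \<in> space P \<and> (\<Sum>i<n. (a i j)\<^sup>2) \<le> 5 * real n * \<rho>")
      case False
      then have "Pair a -` F j = {}" by (auto simp: F_def W_def space_pair_measure)
      then show ?thesis by simp
    next
      case True
      define u where "u i = a i j / sqrt (real n)" for i
      have eq: "Pair a -` F j = {e \<in> space Ne. \<bar>\<Sum>i<n. u i * e i\<bar> > t}"
        using True by (auto simp: F_def W_def space_pair_measure u_def)
      have "bform n (\<lambda>i k. (\<sigma>\<^sup>2 \<cdot>\<^sub>m 1\<^sub>m n) $$ (i, k)) u u = bform n (\<lambda>i k. if i = k then \<sigma>\<^sup>2 else 0) u u"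
        unfolding bform_def by (intro sum.cong arg_cong2[where f="(*)"]) auto
      also have "\<dots> = \<sigma>\<^sup>2 * (\<Sum>i<n. (u i)\<^sup>2)"
        by (simp add: bform_scalar power2_eq_square)
      also have "(\<Sum>i<n. (u i)\<^sup>2) = (\<Sum>i<n. (a i j)\<^sup>2) / real n"
        by (simp add: u_def power_divide sum_divide_distrib)
      also have "\<sigma>\<^sup>2 * \<dots> \<le> \<sigma>\<^sup>2 * (5 * \<rho>)"
        using True n by (intro mult_left_mono) (auto simp: divide_simps mult_ac)
      finally have var: "bform n (\<lambda>i k. (\<sigma>\<^sup>2 \<cdot>\<^sub>m 1\<^sub>m n) $$ (i, k)) u u \<le> 5 * \<rho> * \<sigma>\<^sup>2"
        by (simp add: mult_ac)
      have "measure Ne {e \<in> space Ne. \<bar>\<Sum>i<n. u i * e i\<bar> > t} \<le> ?f"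
        by (rule normal_law_tail[OF prob(2) multivariate_normal_linear(1,2)[OF Ne]
              multivariate_normal_linear(3)[OF Ne] var]) (use pos in auto)
      then show ?thesis unfolding eq by (simp add: Ne.emeasure_eq_measure)
    qed
    have "emeasure W (F j) = (\<integral>\<^sup>+a. emeasure Ne (Pair a -` F j) \<partial>P)"
      unfolding W_def by (rule Ne.emeasure_pair_measure_alt) (use F_sets[OF j] W_def in simp)
    also have "\<dots> \<le> (\<integral>\<^sup>+a. ennreal ?f \<partial>P)"
      by (intro nn_integral_mono sec)
    also have "\<dots> = ennreal ?f"
      by (simp add: P.emeasure_space_1)
    finally show ?thesis by (simp add: W.emeasure_eq_measure)
  qed
  define A' where "A' u = {\<omega> \<in> space W. fst \<omega> \<in> A u}" for u
  define D' where "D' j = {\<omega> \<in> space W. fst \<omega> \<in> D j}" for j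
  have A'_sets: "A' u \<in> sets W" for u
  proof -
    note [measurable] = A_sets[of u]
    show ?thesis unfolding A'_def W_def by measurable
  qed
  have D'_sets: "D' j \<in> sets W" if "j < p" for j
  proof -
    note [measurable] = D_sets[OF that]
    show ?thesis unfolding D'_def W_def by measurable
  qed
  have A'_meas: "measure W (A' u) \<le> exp (- real n / 4)" for u
    unfolding A'_def W_def using measure_pair_fst[OF P prob(2) A_sets[of u]] A_meas[of u] by simp
  have D'_meas: "measure W (D' j) \<le> exp (- real n)" if "j < p" for j
    unfolding D'_def W_def using measure_pair_fst[OF P prob(2) D_sets[OF that]] D_meas[OF that] by simp
  define bad where "bad = (\<Union>u\<in>T. A' u) \<union> (\<Union>j<p. D' j) \<union> (\<Union>j<p. F j)"
  have bad_sets: "bad \<in> sets W"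
    unfolding bad_def using T A'_sets D'_sets F_sets by (intro sets.Un sets.finite_UN) auto
  have "measure W bad \<le> measure W (\<Union>u\<in>T. A' u) + measure W (\<Union>j<p. D' j) + measure W (\<Union>j<p. F j)"
  proof -
    have "measure W bad \<le> measure W ((\<Union>u\<in>T. A' u) \<union> (\<Union>j<p. D' j)) + measure W (\<Union>j<p. F j)"
      unfolding bad_def using T A'_sets D'_sets F_sets
      by (intro measure_Un_le sets.Un sets.finite_UN) auto
    also have "measure W ((\<Union>u\<in>T. A' u) \<union> (\<Union>j<p. D' j)) \<le> measure W (\<Union>u\<in>T. A' u) + measure W (\<Union>j<p. D' j)"
      using T A'_sets D'_sets by (intro measure_Un_le sets.finite_UN) auto
    finally show ?thesis by simp
  qed
  also have "measure W (\<Union>u\<in>T. A' u) \<le> (\<Sum>u\<in>T. measure W (A' u))"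
    using T A'_sets by (intro W.finite_measure_subadditive_finite) auto
  also have "\<dots> \<le> real (card T) * exp (- real n / 4)"
    using sum_bounded_above[of T "\<lambda>u. measure W (A' u)" "exp (- real n / 4)"] A'_meas by simp
  also have "measure W (\<Union>j<p. D' j) \<le> (\<Sum>j<p. measure W (D' j))"
    using D'_sets by (intro W.finite_measure_subadditive_finite) auto
  also have "\<dots> \<le> real p * exp (- real n)"
    using sum_bounded_above[of "{..<p}" "\<lambda>j. measure W (D' j)" "exp (- real n)"] D'_meas by simp
  also have "measure W (\<Union>j<p. F j) \<le> (\<Sum>j<p. measure W (F j))"
    using F_sets by (intro W.finite_measure_subadditive_finite) auto
  also have "\<dots> \<le> real p * ?f"
    using sum_bounded_above[of "{..<p}" "\<lambda>j. measure W (F j)" ?f] F_meas by simp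
  finally have bad: "measure W bad \<le> real (card T) * exp (- real n / 4) + real p * exp (- real n) + real p * ?f"
    by simp
  show ?thesis
    unfolding W
  proof (intro bexI conjI)
    show "space W - bad \<in> sets W" using bad_sets by auto
    show "measure W (space W - bad) \<ge> 1 - real (card T) * exp (- real n / 4) - real p * exp (- real n) - real p * ?f"
      using bad W.prob_compl[OF bad_sets] by simp
    show "\<forall>(a, e)\<in>space W - bad.
      (\<forall>u\<in>T. bform p ?S u u / 4 \<le> (\<Sum>i<n. (\<Sum>j<p. a i j / sqrt (real n) * u j)\<^sup>2)) \<and>
      (\<forall>j<p. (\<Sum>i<n. (a i j / sqrt (real n))\<^sup>2) \<le> 5 * \<rho>) \<and>
      (\<forall>j<p. \<bar>\<Sum>i<n. a i j / sqrt (real n) * e i\<bar> \<le> t)"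
    proof (intro ballI, clarify, intro conjI ballI allI impI)
      fix a e assume ae: "(a, e) \<in> space W" "(a, e) \<notin> bad"
      then have a: "a \<in> space P" by (simp add: W_def space_pair_measure)
      show "bform p ?S u u / 4 \<le> (\<Sum>i<n. (\<Sum>j<p. a i j / sqrt (real n) * u j)\<^sup>2)" if "u \<in> T" for u
      proof -
        have lin: "(\<Sum>j<p. a i j / sqrt (real n) * u j) = (\<Sum>j<p. u j * a i j) / sqrt (real n)" for i
          by (simp add: sum_divide_distrib mult.commute)
        have "(\<Sum>i<n. (\<Sum>j<p. a i j / sqrt (real n) * u j)\<^sup>2) =
            (\<Sum>i<n. (\<Sum>j<p. u j * a i j)\<^sup>2) / real n"
          unfolding lin power_divide sum_divide_distrib[symmetric] by simp
        moreover have "real n * bform p ?S u u / 4 \<le> (\<Sum>i<n. (\<Sum>j<p. u j * a i j)\<^sup>2)"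
          using ae a that by (auto simp: bad_def A'_def A_def not_less)
        ultimately show ?thesis using n by (simp add: pos_le_divide_eq mult.commute)
      qed
      show "(\<Sum>i<n. (a i j / sqrt (real n))\<^sup>2) \<le> 5 * \<rho>" if "j < p" for j
      proof -
        have "(\<Sum>i<n. (a i j)\<^sup>2) \<le> 5 * real n * \<rho>"
          using ae a that by (auto simp: bad_def D'_def D_def not_less)
        then show ?thesis
          using n by (simp add: power_divide sum_divide_distrib[symmetric] pos_divide_le_eq mult_ac)
      qed
      show "\<bar>\<Sum>i<n. a i j / sqrt (real n) * e i\<bar> \<le> t" if "j < p" for j
      proof -
        \<comment> \<open>Avoiding \<open>F j\<close> bounds the correlation only together with the
          column bound, which comes from avoiding \<open>D' j\<close>.\<close>
        have "(\<Sum>i<n. (a i j)\<^sup>2) \<le> 5 * real n * \<rho>"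
          using ae a that by (auto simp: bad_def D'_def D_def not_less)
        then show ?thesis
          using ae that by (auto simp: bad_def F_def not_less)
      qed
    qed
  qed
qed

section \<open>The cone condition and the error bound\<close>

lemma sum_abs_le_sqrt_card:
  fixes v :: "nat \<Rightarrow> real"
  assumes "H \<subseteq> {..<p}"
  shows "(\<Sum>j\<in>H. \<bar>v j\<bar>) \<le> sqrt (real (card H)) * L2_set v {..<p}"
proof -
  have "(\<Sum>j\<in>H. \<bar>1\<bar> * \<bar>v j\<bar>) \<le> L2_set (\<lambda>_. 1) H * L2_set v H"
    by (rule L2_set_mult_ineq)
  also have "L2_set (\<lambda>_. 1::real) H = sqrt (real (card H))"
    by (simp add: L2_set_def)
  also have "L2_set v H \<le> L2_set v {..<p}"
    unfolding L2_set_def using assms by (intro real_sqrt_le_mono sum_mono2) auto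
  finally show ?thesis by (simp add: mult_left_mono)
qed

text \<open>Termwise: off the support of the true vector the left-hand side cancels, and on it the
  triangle inequality gives the factor 2.\<close>

lemma lasso_penalty_decrease:
  fixes x x\<^sub>0 :: "'a \<Rightarrow> real"
  assumes "finite I"
  shows "(\<Sum>j\<in>I. \<bar>x\<^sub>0 j\<bar>) - (\<Sum>j\<in>I. \<bar>x j\<bar>) + (\<Sum>j\<in>I. \<bar>x j - x\<^sub>0 j\<bar>)
    \<le> 2 * (\<Sum>j\<in>{j \<in> I. x\<^sub>0 j \<noteq> 0}. \<bar>x j - x\<^sub>0 j\<bar>)"
proof -
  have "(\<Sum>j\<in>I. \<bar>x\<^sub>0 j\<bar>) - (\<Sum>j\<in>I. \<bar>x j\<bar>) + (\<Sum>j\<in>I. \<bar>x j - x\<^sub>0 j\<bar>) =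
      (\<Sum>j\<in>I. \<bar>x\<^sub>0 j\<bar> - \<bar>x j\<bar> + \<bar>x j - x\<^sub>0 j\<bar>)"
    by (simp add: sum.distrib sum_subtractf)
  also have "\<dots> \<le> (\<Sum>j\<in>I. if x\<^sub>0 j \<noteq> 0 then 2 * \<bar>x j - x\<^sub>0 j\<bar> else 0)"
    by (intro sum_mono) auto
  also have "\<dots> = 2 * (\<Sum>j\<in>{j \<in> I. x\<^sub>0 j \<noteq> 0}. \<bar>x j - x\<^sub>0 j\<bar>)"
    using assms by (subst sum.inter_filter) (auto simp: sum_distrib_left intro!: sum.cong)
  finally show ?thesis .
qed

text \<open>By \<open>noise\<close>, twice the inner product of noise and prediction error costs at
  most half of \<open>lam\<^sub>1\<close> times the l1 norm of \<open>v\<close>, which the lasso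
  penalty outweighs. What is left puts \<open>v\<close> in the cone of \<open>re\<close>; the bound
  on \<open>Q\<close> is linear in the norm of \<open>v\<close>, so one factor of the norm
  cancels.\<close>

lemma fused_lasso_error_bound:
  fixes n p :: nat and x x\<^sub>0 e :: "nat \<Rightarrow> real" and B :: "nat \<Rightarrow> nat \<Rightarrow> real"
  defines "v \<equiv> \<lambda>j. x j - x\<^sub>0 j"
    and "H \<equiv> {j \<in> {..<p}. x\<^sub>0 j \<noteq> 0}" and "J \<equiv> {i. i + 1 < p \<and> x\<^sub>0 i \<noteq> x\<^sub>0 (i + 1)}"
  assumes opt: "(\<Sum>i<n. (e i - (\<Sum>j<p. B i j * v j))\<^sup>2) + lam\<^sub>1 * (\<Sum>j<p. \<bar>x j\<bar>)
        + lam\<^sub>2 * (\<Sum>i<p - 1. \<bar>x i - x (i + 1)\<bar>)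
      \<le> (\<Sum>i<n. (e i)\<^sup>2) + lam\<^sub>1 * (\<Sum>j<p. \<bar>x\<^sub>0 j\<bar>) + lam\<^sub>2 * (\<Sum>i<p - 1. \<bar>x\<^sub>0 i - x\<^sub>0 (i + 1)\<bar>)"
    and noise: "\<And>j. j < p \<Longrightarrow> \<bar>\<Sum>i<n. B i j * e i\<bar> \<le> lam\<^sub>1 / 4"
    and lam: "lam\<^sub>1 > 0" "lam\<^sub>2 \<ge> 0" and \<kappa>: "\<kappa> > 0"
    and re: "\<And>v. (\<Sum>j<p. \<bar>v j\<bar>) \<le> 4 * (1 + lam\<^sub>2 / lam\<^sub>1) * sqrt (real (card J + card H)) * L2_set v {..<p}
      \<Longrightarrow> \<kappa> * (L2_set v {..<p})\<^sup>2 \<le> (\<Sum>i<n. (\<Sum>j<p. B i j * v j)\<^sup>2)"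
  shows "L2_set v {..<p} \<le> (3/2 * lam\<^sub>1 + 2 * lam\<^sub>2) * sqrt (real (max (card J) (card H))) / \<kappa>"
proof -
  define N where "N = L2_set v {..<p}"
  define Q where "Q = (\<Sum>i<n. (\<Sum>j<p. B i j * v j)\<^sup>2)"
  have N0: "N \<ge> 0" and Q0: "Q \<ge> 0" by (auto simp: N_def Q_def sum_nonneg L2_set_nonneg)
  have cross: "2 * (\<Sum>i<n. e i * (\<Sum>j<p. B i j * v j)) \<le> lam\<^sub>1 / 2 * (\<Sum>j<p. \<bar>v j\<bar>)"
  proof -
    have "(\<Sum>i<n. e i * (\<Sum>j<p. B i j * v j)) = (\<Sum>i<n. \<Sum>j<p. v j * (B i j * e i))"
      by (simp add: sum_distrib_left mult_ac)
    also have "\<dots> = (\<Sum>j<p. v j * (\<Sum>i<n. B i j * e i))"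
      by (subst sum.swap) (simp add: sum_distrib_left)
    also have "\<dots> \<le> (\<Sum>j<p. \<bar>v j\<bar> * (lam\<^sub>1 / 4))"
    proof (rule sum_mono)
      fix j assume "j \<in> {..<p}"
      then have "\<bar>v j\<bar> * \<bar>\<Sum>i<n. B i j * e i\<bar> \<le> \<bar>v j\<bar> * (lam\<^sub>1 / 4)"
        by (intro mult_left_mono noise) auto
      then show "v j * (\<Sum>i<n. B i j * e i) \<le> \<bar>v j\<bar> * (lam\<^sub>1 / 4)"
        by (simp only: abs_mult[symmetric])
    qed
    finally show ?thesis unfolding sum_distrib_right[symmetric] by (simp add: mult_ac)
  qed
  have expand: "(\<Sum>i<n. (e i - (\<Sum>j<p. B i j * v j))\<^sup>2) =
      (\<Sum>i<n. (e i)\<^sup>2) - 2 * (\<Sum>i<n. e i * (\<Sum>j<p. B i j * v j)) + Q"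
    unfolding Q_def by (simp add: power2_diff sum.distrib sum_subtractf sum_distrib_left mult.assoc)
  \<comment> \<open>Where the true vector has no jump, the total variation of \<open>x\<close> can
    only add. Each jump involves \<open>v\<close> at \<open>i\<close> and \<open>i + 1\<close>,
    hence at \<open>J\<close> and at its shift, both of size \<open>card J\<close> and below
    \<open>p\<close>.\<close>
  have D: "(\<Sum>i<p - 1. \<bar>x\<^sub>0 i - x\<^sub>0 (i + 1)\<bar>) - (\<Sum>i<p - 1. \<bar>x i - x (i + 1)\<bar>)
      \<le> 2 * sqrt (real (card J)) * N"
  proof -
    have "(\<Sum>i<p - 1. \<bar>x\<^sub>0 i - x\<^sub>0 (i + 1)\<bar>) - (\<Sum>i<p - 1. \<bar>x i - x (i + 1)\<bar>)
        \<le> (\<Sum>i<p - 1. if x\<^sub>0 i \<noteq> x\<^sub>0 (i + 1) then \<bar>v i\<bar> + \<bar>v (i + 1)\<bar> else 0)"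
      unfolding sum_subtractf[symmetric] by (intro sum_mono) (auto simp: v_def)
    also have "\<dots> = (\<Sum>i\<in>{i \<in> {..<p - 1}. x\<^sub>0 i \<noteq> x\<^sub>0 (i + 1)}. \<bar>v i\<bar> + \<bar>v (i + 1)\<bar>)"
      by (subst sum.inter_filter) auto
    also have "{i \<in> {..<p - 1}. x\<^sub>0 i \<noteq> x\<^sub>0 (i + 1)} = J"
      by (auto simp: J_def)
    also have "(\<Sum>i\<in>J. \<bar>v i\<bar> + \<bar>v (i + 1)\<bar>) = (\<Sum>i\<in>J. \<bar>v i\<bar>) + (\<Sum>i\<in>Suc ` J. \<bar>v i\<bar>)"
      by (simp add: sum.distrib sum.reindex)
    also have "(\<Sum>i\<in>J. \<bar>v i\<bar>) \<le> sqrt (real (card J)) * N"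
      unfolding N_def by (rule sum_abs_le_sqrt_card) (auto simp: J_def)
    also have "(\<Sum>i\<in>Suc ` J. \<bar>v i\<bar>) \<le> sqrt (real (card J)) * N"
      using sum_abs_le_sqrt_card[of "Suc ` J" p v] by (auto simp: J_def N_def card_image)
    finally show ?thesis by (simp add: mult_ac)
  qed
  have Hb: "(\<Sum>j\<in>H. \<bar>v j\<bar>) \<le> sqrt (real (card H)) * N"
    unfolding N_def by (rule sum_abs_le_sqrt_card) (auto simp: H_def)
  have L: "(\<Sum>j<p. \<bar>x\<^sub>0 j\<bar>) - (\<Sum>j<p. \<bar>x j\<bar>) \<le> 2 * (sqrt (real (card H)) * N) - (\<Sum>j<p. \<bar>v j\<bar>)"
  proof -
    have "(\<Sum>j<p. \<bar>x\<^sub>0 j\<bar>) - (\<Sum>j<p. \<bar>x j\<bar>) + (\<Sum>j<p. \<bar>v j\<bar>) \<le> 2 * (\<Sum>j\<in>H. \<bar>v j\<bar>)"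
      using lasso_penalty_decrease[of "{..<p}" x\<^sub>0 x] by (simp only: v_def H_def finite_lessThan)
    then show ?thesis using Hb by linarith
  qed
  \<comment> \<open>A second bound on the same decrease: it gives up the negative l1 term of
    \<open>L\<close> and halves the support term in return.\<close>
  have L': "(\<Sum>j<p. \<bar>x\<^sub>0 j\<bar>) - (\<Sum>j<p. \<bar>x j\<bar>) \<le> sqrt (real (card H)) * N"
  proof -
    have "(\<Sum>j<p. \<bar>x\<^sub>0 j\<bar>) - (\<Sum>j<p. \<bar>x j\<bar>) \<le> (\<Sum>j<p. if x\<^sub>0 j \<noteq> 0 then \<bar>v j\<bar> else 0)"
      unfolding sum_subtractf[symmetric] by (intro sum_mono) (auto simp: v_def)
    also have "\<dots> = (\<Sum>j\<in>H. \<bar>v j\<bar>)" unfolding H_def by (subst sum.inter_filter) auto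
    finally show ?thesis using Hb by linarith
  qed
  define a b where "a = sqrt (real (card H)) * N" and "b = sqrt (real (card J)) * N"
  have ab: "a \<ge> 0" "b \<ge> 0" using N0 by (auto simp: a_def b_def)
  have basic: "Q + lam\<^sub>1 / 2 * (\<Sum>j<p. \<bar>v j\<bar>) \<le> 2 * lam\<^sub>1 * a + 2 * lam\<^sub>2 * b"
  proof -
    have "lam\<^sub>1 * ((\<Sum>j<p. \<bar>x\<^sub>0 j\<bar>) - (\<Sum>j<p. \<bar>x j\<bar>)) \<le> lam\<^sub>1 * (2 * a - (\<Sum>j<p. \<bar>v j\<bar>))"
      "lam\<^sub>2 * ((\<Sum>i<p - 1. \<bar>x\<^sub>0 i - x\<^sub>0 (i + 1)\<bar>) - (\<Sum>i<p - 1. \<bar>x i - x (i + 1)\<bar>)) \<le> lam\<^sub>2 * (2 * b)"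
      using lam L D by (intro mult_left_mono; simp add: a_def b_def)+
    then show ?thesis using opt cross unfolding expand by (simp add: algebra_simps)
  qed
  have "(\<Sum>j<p. \<bar>v j\<bar>) \<le> 4 * (1 + lam\<^sub>2 / lam\<^sub>1) * sqrt (real (card J + card H)) * N"
  proof -
    have "lam\<^sub>1 / 2 * (\<Sum>j<p. \<bar>v j\<bar>) \<le> 2 * lam\<^sub>1 * a + 2 * lam\<^sub>2 * b"
      using basic Q0 by linarith
    then have "(\<Sum>j<p. \<bar>v j\<bar>) \<le> 4 * (a + lam\<^sub>2 / lam\<^sub>1 * b)"
      using lam by (simp add: field_simps)
    also have "a + lam\<^sub>2 / lam\<^sub>1 * b \<le>
        sqrt (real (card J + card H)) * N + lam\<^sub>2 / lam\<^sub>1 * (sqrt (real (card J + card H)) * N)"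
      unfolding a_def b_def using lam N0 by (intro add_mono mult_left_mono mult_right_mono) auto
    finally show ?thesis by (simp add: algebra_simps)
  qed
  then have "\<kappa> * N\<^sup>2 \<le> Q" unfolding N_def Q_def by (rule re)
  \<comment> \<open>The bounds from \<open>L\<close> and \<open>L'\<close> contain half of
    \<open>lam\<^sub>1\<close> times the l1 norm of \<open>v\<close> with opposite signs. Their
    average is free of it, and 2 and 1 average to 3/2.\<close>
  also have "Q \<le> 3/2 * lam\<^sub>1 * a + 2 * lam\<^sub>2 * b"
  proof -
    have "Q + lam\<^sub>1 / 2 * (\<Sum>j<p. \<bar>v j\<bar>) \<le> lam\<^sub>1 * a + lam\<^sub>1 * (\<Sum>j<p. \<bar>v j\<bar>) + 2 * lam\<^sub>2 * b"
    proof -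
      have "lam\<^sub>1 * ((\<Sum>j<p. \<bar>x\<^sub>0 j\<bar>) - (\<Sum>j<p. \<bar>x j\<bar>)) \<le> lam\<^sub>1 * a"
        "lam\<^sub>2 * ((\<Sum>i<p - 1. \<bar>x\<^sub>0 i - x\<^sub>0 (i + 1)\<bar>) - (\<Sum>i<p - 1. \<bar>x i - x (i + 1)\<bar>)) \<le> lam\<^sub>2 * (2 * b)"
        using lam L' D by (intro mult_left_mono; simp add: a_def b_def)+
      then show ?thesis using opt cross unfolding expand by (simp add: algebra_simps)
    qed
    then show ?thesis using basic by argo
  qed
  finally have main: "\<kappa> * N\<^sup>2 \<le> 3/2 * lam\<^sub>1 * a + 2 * lam\<^sub>2 * b" .
  define m where "m = sqrt (real (max (card J) (card H)))"
  have "a \<le> m * N" "b \<le> m * N"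
    unfolding a_def b_def m_def using N0 by (auto intro!: mult_right_mono)
  then have "3/2 * lam\<^sub>1 * a + 2 * lam\<^sub>2 * b \<le> 3/2 * lam\<^sub>1 * (m * N) + 2 * lam\<^sub>2 * (m * N)"
    using lam by (intro add_mono mult_left_mono) auto
  then have "N * (\<kappa> * N) \<le> N * ((3/2 * lam\<^sub>1 + 2 * lam\<^sub>2) * m)"
    using main by (simp add: algebra_simps power2_eq_square)
  moreover have "0 \<le> (3/2 * lam\<^sub>1 + 2 * lam\<^sub>2) * m"
    using lam by (simp add: m_def)
  \<comment> \<open>For zero error nothing can be cancelled, and the nonnegative right-hand side
    suffices.\<close>
  ultimately have "\<kappa> * N \<le> (3/2 * lam\<^sub>1 + 2 * lam\<^sub>2) * m"
    using N0 by (cases "N = 0") auto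
  then show ?thesis
    unfolding N_def[symmetric] m_def[symmetric] using \<kappa> by (simp add: pos_le_divide_eq mult.commute)
qed

section \<open>The objective in coordinates, and the numerical probability estimates\<close>

text \<open>Centring at the true vector makes the residual depend on \<open>x\<close> only through
  the error, so that at \<open>x = x\<^sub>0\<close> it is the noise.\<close>

lemma fused_lasso_objective_eq:
  fixes x x\<^sub>0 :: "real vec"
  assumes x: "x \<in> carrier_vec p" and x\<^sub>0: "x\<^sub>0 \<in> carrier_vec p"
  shows "fused_lasso_objective lam\<^sub>1 lam\<^sub>2 (design_mat n p a *\<^sub>v x\<^sub>0 + vec n e) (design_mat n p a) x =
    (\<Sum>i<n. (e i - (\<Sum>j<p. a i j / sqrt (real n) * (x $ j - x\<^sub>0 $ j)))\<^sup>2)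
      + lam\<^sub>1 * (\<Sum>j<p. \<bar>x $ j\<bar>) + lam\<^sub>2 * (\<Sum>i<p - 1. \<bar>x $ i - x $ (i + 1)\<bar>)"
proof -
  have mv: "(design_mat n p a *\<^sub>v z) $ i = (\<Sum>j<p. a i j / sqrt (real n) * z $ j)"
    if "z \<in> carrier_vec p" "i < n" for z i
    using that by (simp add: design_mat_def scalar_prod_def atLeast0LessThan)
  have res: "(design_mat n p a *\<^sub>v x\<^sub>0 + vec n e - design_mat n p a *\<^sub>v x) $ i =
      e i - (\<Sum>j<p. a i j / sqrt (real n) * (x $ j - x\<^sub>0 $ j))" if i: "i < n" for i
  proof -
    have "(design_mat n p a *\<^sub>v x\<^sub>0 + vec n e - design_mat n p a *\<^sub>v x) $ i =
        (design_mat n p a *\<^sub>v x\<^sub>0) $ i + e i - (design_mat n p a *\<^sub>v x) $ i"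
      using i by (simp add: design_mat_def)
    then show ?thesis
      unfolding mv[OF x i] mv[OF x\<^sub>0 i] by (simp add: right_diff_distrib sum_subtractf)
  qed
  have dm: "(diff_mat p *\<^sub>v x) $ i = x $ i - x $ (i + 1)" if "i < p - 1" for i
  proof -
    have "(diff_mat p *\<^sub>v x) $ i =
        (\<Sum>j<p. ((if i = j then 1 else 0) - (if j = i + 1 then 1 else 0)) * x $ j)"
      using that x by (simp add: diff_mat_def scalar_prod_def atLeast0LessThan)
    also have "\<dots> = (\<Sum>j<p. (if j = i then x $ j else 0) - (if j = i + 1 then x $ j else 0))"
      by (intro sum.cong) auto
    also have "\<dots> = x $ i - x $ (i + 1)"
      using that by (auto simp: sum_subtractf)
    finally show ?thesis .
  qed
  have "(vec_l2_norm (design_mat n p a *\<^sub>v x\<^sub>0 + vec n e - design_mat n p a *\<^sub>v x))\<^sup>2 =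
      (\<Sum>i<n. (e i - (\<Sum>j<p. a i j / sqrt (real n) * (x $ j - x\<^sub>0 $ j)))\<^sup>2)"
  proof -
    have dim: "dim_vec (design_mat n p a *\<^sub>v x\<^sub>0 + vec n e - design_mat n p a *\<^sub>v x) = n"
      by (simp add: design_mat_def)
    show ?thesis
      unfolding vec_l2_norm_def dim L2_set_def
      by (subst real_sqrt_pow2) (auto intro!: sum_nonneg sum.cong simp del: index_minus_vec simp: res)
  qed
  moreover have "vec_l1_norm (diff_mat (dim_vec x) *\<^sub>v x) = (\<Sum>i<p - 1. \<bar>x $ i - x $ (i + 1)\<bar>)"
    using x dm by (auto simp: vec_l1_norm_def diff_mat_def intro!: sum.cong)
  moreover have "vec_l1_norm x = (\<Sum>j<p. \<bar>x $ j\<bar>)"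
    using x by (simp add: vec_l1_norm_def)
  ultimately show ?thesis by (simp only: fused_lasso_objective_def)
qed

text \<open>Since 2 \<le> p, the cardinality is at most p^(2d) \<le> exp(n/8), which uses up half of
  the rate n/4 of the lower tail.\<close>

lemma card_signed_sums_exp_le:
  assumes p: "p \<ge> 2" and d: "real d * ln (real p) \<le> real n / 16"
  shows "real (card (signed_sums p d)) * exp (- real n / 4) \<le> exp (- (1/8 * real n))"
proof -
  have "real (card (signed_sums p d)) \<le> real ((2 * p) ^ d)"
    using card_signed_sums_le[of p d] by (simp only: of_nat_le_iff)
  also have "\<dots> = exp (real d * (ln 2 + ln (real p)))"
    using p by (simp add: exp_of_nat_mult exp_add)
  also have "\<dots> \<le> exp (real d * (ln (real p) + ln (real p)))"
    using p by (simp add: mult_left_mono)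
  also have "\<dots> \<le> exp (real n / 8)"
    using d by (simp add: algebra_simps)
  finally have "real (card (signed_sums p d)) * exp (- real n / 4) \<le> exp (real n / 8) * exp (- real n / 4)"
    by (intro mult_right_mono) auto
  then show ?thesis by (simp add: mult_exp_exp)
qed

text \<open>With threshold \<open>lam\<^sub>1 / 4\<close> the tail exponent is 3 c^2 / 640 times ln
  q, the denominator being 16 * 8 * 5. It has to be at least 2 ln q, so that one factor 1/q survives
  the union over p \<le> q columns; c = 21 achieves this.\<close>

lemma noise_probability_le:
  fixes c \<sigma> \<rho> q :: real
  assumes c: "c \<ge> 21" and pos: "\<sigma> > 0" "\<rho> > 0" and q: "q \<ge> 1" and p: "real p \<le> q"
  shows "real p * (2 * exp (- (3 * (c * \<sigma> * sqrt (\<rho> * ln q) / 4)\<^sup>2 / (8 * (5 * \<rho> * \<sigma>\<^sup>2))))) \<le> 2 / q"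
proof -
  have lnq: "ln q \<ge> 0" using q by simp
  have "3 * (c * \<sigma> * sqrt (\<rho> * ln q) / 4)\<^sup>2 / (8 * (5 * \<rho> * \<sigma>\<^sup>2)) = 3 * c\<^sup>2 / 640 * ln q"
    using pos lnq by (simp add: power_mult_distrib power_divide)
  moreover have "3 * c\<^sup>2 / 640 \<ge> 2"
    using power_mono[of 21 c 2] c by simp
  then have "2 * ln q \<le> 3 * c\<^sup>2 / 640 * ln q"
    using lnq by (rule mult_right_mono)
  ultimately have "exp (- (3 * (c * \<sigma> * sqrt (\<rho> * ln q) / 4)\<^sup>2 / (8 * (5 * \<rho> * \<sigma>\<^sup>2)))) \<le> exp (- (2 * ln q))"
    by simp
  also have "\<dots> = 1 / q\<^sup>2"
    using q by (simp add: exp_minus exp_double divide_inverse power2_eq_square)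
  finally have "real p * (2 * exp (- (3 * (c * \<sigma> * sqrt (\<rho> * ln q) / 4)\<^sup>2 / (8 * (5 * \<rho> * \<sigma>\<^sup>2))))) \<le> q * (2 * (1 / q\<^sup>2))"
    using p q by (intro mult_mono) auto
  also have "\<dots> = 2 / q" using q by (simp add: power2_eq_square)
  finally show ?thesis .
qed

section \<open>Choice of the constants and conclusion\<close>

text \<open>\<open>xt\<close> is an arbitrary choice of minimisers, possibly not measurable; the
  probability is therefore that of a measurable event on which the error bound holds.\<close>

theorem theorem4:
  fixes l \<rho> :: real
  assumes "l > 0" and "\<rho> > 0"
  shows "\<exists>K\<^sub>1>0. \<exists>K\<^sub>2>0. \<forall>Clam\<^sub>1\<ge>K\<^sub>1. \<forall>Clam\<^sub>2\<ge>K\<^sub>2.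
    \<exists>C\<^sub>1>0. \<exists>C>0. \<exists>c\<^sub>1>0. \<exists>c\<^sub>2>0. \<exists>c\<^sub>3>0.
    \<forall>(n::nat) (p::nat) (\<sigma>::real) (\<Sigma>::real mat) (x\<^sub>0::real vec) Na Ne s h lam\<^sub>1 lam\<^sub>2
       (xt :: (nat \<Rightarrow> nat \<Rightarrow> real) \<times> (nat \<Rightarrow> real) \<Rightarrow> real vec).
      n \<ge> 1 \<longrightarrow> p \<ge> 1 \<longrightarrow> \<sigma> > 0 \<longrightarrow>
      x\<^sub>0 \<in> carrier_vec p \<longrightarrow>
      s = card (jump_set x\<^sub>0) \<longrightarrow> s \<ge> 1 \<longrightarrow> h = card (support_set x\<^sub>0) \<longrightarrow>
      multivariate_normal p (0\<^sub>v p) \<Sigma> Na \<longrightarrow>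
      smallest_singular_value \<Sigma> \<ge> l \<longrightarrow> mat_sup_norm \<Sigma> \<le> \<rho> \<longrightarrow>
      multivariate_normal n (0\<^sub>v n) (\<sigma>\<^sup>2 \<cdot>\<^sub>m 1\<^sub>m n) Ne \<longrightarrow>
      real (s + h) * ln (real p) \<le> C\<^sub>1 * real n \<longrightarrow>
      lam\<^sub>1 = Clam\<^sub>1 * \<sigma> * sqrt (\<rho> * ln (real (max p n))) \<longrightarrow>
      lam\<^sub>2 = Clam\<^sub>2 * \<sigma> * sqrt (ln (real (max p n))) \<longrightarrow>
      (\<forall>(a, e) \<in> space (sample_law n Na Ne).
         is_arg_min
           (fused_lasso_objective lam\<^sub>1 lam\<^sub>2
              (design_mat n p a *\<^sub>v x\<^sub>0 + vec n e) (design_mat n p a))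
           (\<lambda>x. x \<in> carrier_vec p) (xt (a, e))) \<longrightarrow>
      (\<exists>E \<in> sets (sample_law n Na Ne).
         measure (sample_law n Na Ne) E
           \<ge> 1 - c\<^sub>1 / real (max p n) - real p * exp (- real n) - c\<^sub>2 * exp (- (c\<^sub>3 * real n)) \<and>
         (\<forall>\<omega>\<in>E. (vec_l2_norm (xt \<omega> - x\<^sub>0))\<^sup>2
                   \<le> C * \<sigma>\<^sup>2 * ln (real (max p n)) * real (max s h)))"
proof -
  have main: "\<exists>C\<^sub>1>0. \<exists>C>0. \<exists>c\<^sub>1>0. \<exists>c\<^sub>2>0. \<exists>c\<^sub>3>0.
    \<forall>(n::nat) (p::nat) (\<sigma>::real) (\<Sigma>::real mat) (x\<^sub>0::real vec) Na Ne s h lam\<^sub>1 lam\<^sub>2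
       (xt :: (nat \<Rightarrow> nat \<Rightarrow> real) \<times> (nat \<Rightarrow> real) \<Rightarrow> real vec).
      n \<ge> 1 \<longrightarrow> p \<ge> 1 \<longrightarrow> \<sigma> > 0 \<longrightarrow>
      x\<^sub>0 \<in> carrier_vec p \<longrightarrow>
      s = card (jump_set x\<^sub>0) \<longrightarrow> s \<ge> 1 \<longrightarrow> h = card (support_set x\<^sub>0) \<longrightarrow>
      multivariate_normal p (0\<^sub>v p) \<Sigma> Na \<longrightarrow>
      smallest_singular_value \<Sigma> \<ge> l \<longrightarrow> mat_sup_norm \<Sigma> \<le> \<rho> \<longrightarrow>
      multivariate_normal n (0\<^sub>v n) (\<sigma>\<^sup>2 \<cdot>\<^sub>m 1\<^sub>m n) Ne \<longrightarrow>
      real (s + h) * ln (real p) \<le> C\<^sub>1 * real n \<longrightarrow>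
      lam\<^sub>1 = L1 * \<sigma> * sqrt (\<rho> * ln (real (max p n))) \<longrightarrow>
      lam\<^sub>2 = L2 * \<sigma> * sqrt (ln (real (max p n))) \<longrightarrow>
      (\<forall>(a, e) \<in> space (sample_law n Na Ne).
         is_arg_min
           (fused_lasso_objective lam\<^sub>1 lam\<^sub>2
              (design_mat n p a *\<^sub>v x\<^sub>0 + vec n e) (design_mat n p a))
           (\<lambda>x. x \<in> carrier_vec p) (xt (a, e))) \<longrightarrow>
      (\<exists>E \<in> sets (sample_law n Na Ne).
         measure (sample_law n Na Ne) E
           \<ge> 1 - c\<^sub>1 / real (max p n) - real p * exp (- real n) - c\<^sub>2 * exp (- (c\<^sub>3 * real n)) \<and>
         (\<forall>\<omega>\<in>E. (vec_l2_norm (xt \<omega> - x\<^sub>0))\<^sup>2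
                   \<le> C * \<sigma>\<^sup>2 * ln (real (max p n)) * real (max s h)))"
    if L1: "L1 \<ge> 21" and L2: "L2 \<ge> 1" for L1 L2 :: real
  proof -
    \<comment> \<open>\<open>K\<close> is the cone constant; the ratio of the two tuning parameters
      is free of \<sigma> and of the logarithm. \<kappa> is fixed by
      \<open>5 * \<rho> * K\<^sup>2 = l / 8 * \<kappa>\<close>, so that about \<kappa> (s + h) draws
      suffice. \<open>G\<close> is the error constant with restricted eigenvalue l/8.\<close>
    define K where "K = 4 * (1 + L2 / (L1 * sqrt \<rho>))"
    define \<kappa> where "\<kappa> = 40 * \<rho> * K\<^sup>2 / l"
    define G where "G = (3/2 * (L1 * sqrt \<rho>) + 2 * L2) / (l / 8)"
    have \<kappa>: "\<kappa> \<ge> 0" and G: "G > 0"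
      using assms L1 L2 by (auto simp: \<kappa>_def G_def add_pos_pos)
    show ?thesis
    \<comment> \<open>The first witness makes \<open>d * ln p\<close> at most n/16 for d \<le>
      (\<kappa> + 3)(s + h). The 2 is the noise term, and 1 and 1/8 come from the union over signed
      sums.\<close>
    proof (rule exI[of _ "1 / (16 * (\<kappa> + 3))"], intro conjI, use \<kappa> in simp,
        rule exI[of _ "G\<^sup>2"], intro conjI, use G in simp,
        rule exI[of _ 2], intro conjI, simp, rule exI[of _ 1], intro conjI, simp,
        rule exI[of _ "1/8"], intro conjI allI impI, simp)
      fix n p :: nat and \<sigma> :: real and S :: "real mat" and x\<^sub>0 :: "real vec" and Na Ne
        and s h :: nat and lam\<^sub>1 lam\<^sub>2 :: real
        and xt :: "(nat \<Rightarrow> nat \<Rightarrow> real) \<times> (nat \<Rightarrow> real) \<Rightarrow> real vec"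
      assume n: "n \<ge> 1" and p1: "p \<ge> 1" and \<sigma>: "\<sigma> > 0" and x\<^sub>0: "x\<^sub>0 \<in> carrier_vec p"
        and s: "s = card (jump_set x\<^sub>0)" "s \<ge> 1" and h: "h = card (support_set x\<^sub>0)"
        and Na: "multivariate_normal p (0\<^sub>v p) S Na"
        and sing: "smallest_singular_value S \<ge> l" and sup: "mat_sup_norm S \<le> \<rho>"
        and Ne: "multivariate_normal n (0\<^sub>v n) (\<sigma>\<^sup>2 \<cdot>\<^sub>m 1\<^sub>m n) Ne"
        and size: "real (s + h) * ln (real p) \<le> 1 / (16 * (\<kappa> + 3)) * real n"
        and lam\<^sub>1: "lam\<^sub>1 = L1 * \<sigma> * sqrt (\<rho> * ln (real (max p n)))"
        and lam\<^sub>2: "lam\<^sub>2 = L2 * \<sigma> * sqrt (ln (real (max p n)))"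
        and arg_min: "\<forall>(a, e) \<in> space (sample_law n Na Ne).
         is_arg_min
           (fused_lasso_objective lam\<^sub>1 lam\<^sub>2
              (design_mat n p a *\<^sub>v x\<^sub>0 + vec n e) (design_mat n p a))
           (\<lambda>x. x \<in> carrier_vec p) (xt (a, e))"
      define m where "m = real (s + h)"
      define q where "q = real (max p n)"
      define \<tau> where "\<tau> = \<sigma> * sqrt (ln q)"
      have m: "m \<ge> 1" using s(2) by (simp add: m_def)
      \<comment> \<open>A jump needs two coordinates. This makes ln q, and with it both tuning
        parameters, strictly positive.\<close>
      have p: "p \<ge> 2"
      proof -
        have "jump_set x\<^sub>0 \<noteq> {}" using s by auto
        then show ?thesis using x\<^sub>0 by (auto simp: jump_set_def)
      qed
      have q: "q \<ge> 2" "real p \<le> q" using p by (auto simp: q_def)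
      have \<tau>: "\<tau> > 0" using \<sigma> q by (simp add: \<tau>_def)
      have lam: "lam\<^sub>1 = L1 * sqrt \<rho> * \<tau>" "lam\<^sub>2 = L2 * \<tau>"
        unfolding lam\<^sub>1 lam\<^sub>2 q_def[symmetric] \<tau>_def real_sqrt_mult by simp_all
      have lam_pos: "lam\<^sub>1 > 0" "lam\<^sub>2 \<ge> 0"
        using assms L1 L2 \<tau> by (auto simp: lam)
      have K_eq: "4 * (1 + lam\<^sub>2 / lam\<^sub>1) = K"
        using \<tau> by (simp add: lam K_def)
      have S: "S \<in> carrier_mat p p" and sym: "transpose_mat S = S"
        and psd: "\<And>u. u \<in> carrier_vec p \<Longrightarrow> 0 \<le> u \<bullet> (S *\<^sub>v u)"
        using Na by (auto simp: multivariate_normal_def)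
      have S_sym: "S $$ (i, j) = S $$ (j, i)" if "i < p" "j < p" for i j
        using that S arg_cong[OF sym, of "\<lambda>T. T $$ (i, j)"] by auto
      have S_ge: "l * (\<Sum>j<p. (v j)\<^sup>2) \<le> bform p (\<lambda>i j. S $$ (i, j)) v v" for v
      proof -
        have "l * (\<Sum>j<p. (v j)\<^sup>2) \<le> smallest_singular_value S * (\<Sum>j<p. (v j)\<^sup>2)"
          using sing by (intro mult_right_mono) (auto intro: sum_nonneg)
        also have "\<dots> \<le> bform p (\<lambda>i j. S $$ (i, j)) v v"
          by (rule bform_ge_smallest_singular_value[OF S sym _ psd]) (use p in auto)
        finally show ?thesis .
      qed
      have diag_pos: "0 < S $$ (j, j)" if "j < p" for j
      proof -
        have "(\<Sum>i<p. (if i = j then 1 else 0 :: real)\<^sup>2) = 1"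
          using that by (simp add: if_distrib[of "\<lambda>x. x\<^sup>2"] cong: if_cong)
        then show ?thesis
          using S_ge[of "\<lambda>i. if i = j then 1 else 0"] bform_unit[OF that, of "\<lambda>i j. S $$ (i, j)"] assms
          by simp
      qed
      have diag_le: "S $$ (j, j) \<le> \<rho>" if "j < p" for j
      proof -
        have "\<bar>S $$ (j, j)\<bar> \<le> mat_sup_norm S"
          unfolding mat_sup_norm_def
          by (intro Max_ge imageI elements_matI[OF S that that] finite_imageI)
            (auto simp: elements_mat_def)
        then show ?thesis using sup by simp
      qed
      \<comment> \<open>The summand 2 secures \<open>d \<ge> 2\<close>; rounding up loses less than
        1, so \<open>d\<close> is at most \<kappa> m + 3, which m \<ge> 1 absorbs into (\<kappa> +
        3) m.\<close>
      define d where "d = 2 + nat \<lceil>\<kappa> * m\<rceil>"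
      have "real (nat \<lceil>\<kappa> * m\<rceil>) = of_int \<lceil>\<kappa> * m\<rceil>"
        using \<kappa> m by simp
      then have d: "d \<ge> 2" "\<kappa> * m \<le> real d - 1" "real d \<le> \<kappa> * m + 3"
        unfolding d_def by linarith+
      have "real d \<le> (\<kappa> + 3) * m"
        using d(3) m by (simp add: algebra_simps)
      then have "real d * ln (real p) \<le> (\<kappa> + 3) * m * ln (real p)"
        using p by (intro mult_right_mono) auto
      also have "\<dots> \<le> (\<kappa> + 3) * (1 / (16 * (\<kappa> + 3)) * real n)"
        using size \<kappa> unfolding m_def[symmetric] mult.assoc by (intro mult_left_mono) auto
      also have "\<dots> = real n / 16" using \<kappa> by (simp add: field_simps)
      finally have card_T: "real (card (signed_sums p d)) * exp (- real n / 4) \<le> exp (- (1/8 * real n))"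
        by (rule card_signed_sums_exp_le[OF p])
      have t: "lam\<^sub>1 / 4 > 0" using lam_pos by simp
      obtain E where E: "E \<in> sets (sample_law n Na Ne)"
        and E_meas: "measure (sample_law n Na Ne) E \<ge> 1 - real (card (signed_sums p d)) * exp (- real n / 4)
          - real p * exp (- real n) - real p * (2 * exp (- (3 * (lam\<^sub>1 / 4)\<^sup>2 / (8 * (5 * \<rho> * \<sigma>\<^sup>2)))))"
        and good: "\<forall>(a, e)\<in>E.
          (\<forall>u\<in>signed_sums p d. bform p (\<lambda>i j. S $$ (i, j)) u u / 4
            \<le> (\<Sum>i<n. (\<Sum>j<p. a i j / sqrt (real n) * u j)\<^sup>2)) \<and>
          (\<forall>j<p. (\<Sum>i<n. (a i j / sqrt (real n))\<^sup>2) \<le> 5 * \<rho>) \<and>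
          (\<forall>j<p. \<bar>\<Sum>i<n. a i j / sqrt (real n) * e i\<bar> \<le> lam\<^sub>1 / 4)"
        using sample_law_good_event[OF Na Ne n \<sigma> assms(2) t finite_signed_sums[of p d] diag_pos diag_le]
        by blast
      have noise: "real p * (2 * exp (- (3 * (lam\<^sub>1 / 4)\<^sup>2 / (8 * (5 * \<rho> * \<sigma>\<^sup>2))))) \<le> 2 / q"
        unfolding lam\<^sub>1 q_def[symmetric]
        by (rule noise_probability_le[OF L1 \<sigma> assms(2)]) (use q in auto)
      \<comment> \<open>From here on the argument is deterministic, at one outcome of the good
        event.\<close>
      have bound: "(vec_l2_norm (xt \<omega> - x\<^sub>0))\<^sup>2 \<le> G\<^sup>2 * \<sigma>\<^sup>2 * ln q * real (max s h)" if \<omega>: "\<omega> \<in> E" for \<omega>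
      proof -
        obtain a e where ae: "\<omega> = (a, e)" by (cases \<omega>)
        define B where "B i j = a i j / sqrt (real n)" for i j
        define v where "v j = xt \<omega> $ j - x\<^sub>0 $ j" for j
        have T: "bform p (\<lambda>i j. S $$ (i, j)) u u / 4 \<le> (\<Sum>i<n. (\<Sum>j<p. B i j * u j)\<^sup>2)"
          if "u \<in> signed_sums p d" for u
          using good \<omega> that unfolding ae B_def by blast
        have col: "(\<Sum>i<n. (B i j)\<^sup>2) \<le> 5 * \<rho>" and eps: "\<bar>\<Sum>i<n. B i j * e i\<bar> \<le> lam\<^sub>1 / 4"
          if "j < p" for j
          using good \<omega> that unfolding ae B_def by blast+
        have "\<omega> \<in> space (sample_law n Na Ne)"
          using sets.sets_into_space[OF E] \<omega> by blast
        then have am: "is_arg_min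
           (fused_lasso_objective lam\<^sub>1 lam\<^sub>2 (design_mat n p a *\<^sub>v x\<^sub>0 + vec n e) (design_mat n p a))
           (\<lambda>x. x \<in> carrier_vec p) (xt \<omega>)"
          using arg_min unfolding ae by blast
        then have xt: "xt \<omega> \<in> carrier_vec p" by (simp add: is_arg_min_def)
        have "fused_lasso_objective lam\<^sub>1 lam\<^sub>2 (design_mat n p a *\<^sub>v x\<^sub>0 + vec n e) (design_mat n p a) (xt \<omega>)
          \<le> fused_lasso_objective lam\<^sub>1 lam\<^sub>2 (design_mat n p a *\<^sub>v x\<^sub>0 + vec n e) (design_mat n p a) x\<^sub>0"
          using am x\<^sub>0 by (auto simp: is_arg_min_def not_less)
        then have opt: "(\<Sum>i<n. (e i - (\<Sum>j<p. B i j * (xt \<omega> $ j - x\<^sub>0 $ j)))\<^sup>2) + lam\<^sub>1 * (\<Sum>j<p. \<bar>xt \<omega> $ j\<bar>)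
            + lam\<^sub>2 * (\<Sum>i<p - 1. \<bar>xt \<omega> $ i - xt \<omega> $ (i + 1)\<bar>)
          \<le> (\<Sum>i<n. (e i)\<^sup>2) + lam\<^sub>1 * (\<Sum>j<p. \<bar>x\<^sub>0 $ j\<bar>) + lam\<^sub>2 * (\<Sum>i<p - 1. \<bar>x\<^sub>0 $ i - x\<^sub>0 $ (i + 1)\<bar>)"
          unfolding fused_lasso_objective_eq[OF xt x\<^sub>0] fused_lasso_objective_eq[OF x\<^sub>0 x\<^sub>0] B_def by simp
        have J: "{i. i + 1 < p \<and> x\<^sub>0 $ i \<noteq> x\<^sub>0 $ (i + 1)} = jump_set x\<^sub>0"
          and H: "{j \<in> {..<p}. x\<^sub>0 $ j \<noteq> 0} = support_set x\<^sub>0"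
          using x\<^sub>0 by (auto simp: jump_set_def support_set_def)
        have re: "l / 8 * (L2_set z {..<p})\<^sup>2 \<le> (\<Sum>i<n. (\<Sum>j<p. B i j * z j)\<^sup>2)"
          if z: "(\<Sum>j<p. \<bar>z j\<bar>) \<le> 4 * (1 + lam\<^sub>2 / lam\<^sub>1) * sqrt (real (s + h)) * L2_set z {..<p}" for z
        proof -
          have l2: "(L2_set z {..<p})\<^sup>2 = (\<Sum>j<p. (z j)\<^sup>2)"
            by (simp add: L2_set_def sum_nonneg)
          have "(\<Sum>j<p. \<bar>z j\<bar>)\<^sup>2 \<le> (K * sqrt m * L2_set z {..<p})\<^sup>2"
            using z unfolding K_eq m_def[symmetric] by (intro power_mono sum_nonneg) auto
          also have "\<dots> = K\<^sup>2 * m * (\<Sum>j<p. (z j)\<^sup>2)"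
            using m unfolding l2[symmetric] by (simp add: power_mult_distrib)
          finally have cone: "(\<Sum>j<p. \<bar>z j\<bar>)\<^sup>2 \<le> K\<^sup>2 * m * (\<Sum>j<p. (z j)\<^sup>2)" .
          have "5 * \<rho> * (K\<^sup>2 * m) = l / 8 * (\<kappa> * m)"
            using assms by (simp add: \<kappa>_def)
          also have "\<dots> \<le> l / 8 * (real d - 1)"
            using d(2) assms by (intro mult_left_mono) auto
          finally have R: "5 * \<rho> * (K\<^sup>2 * m) \<le> l / 8 * (real d - 1)" .
          show ?thesis
            unfolding l2
            by (rule restricted_eigenvalue_of_signed_sums[where S = "\<lambda>i j. S $$ (i, j)" and d = d and b = "5 * \<rho>",
                OF S_sym _ S_ge T col d(1) _ R cone])
              (use diag_pos assms in \<open>auto simp: less_imp_le\<close>)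
        qed
        have "L2_set v {..<p} \<le> (3/2 * lam\<^sub>1 + 2 * lam\<^sub>2) * sqrt (real (max s h)) / (l / 8)"
          using fused_lasso_error_bound[where x = "\<lambda>j. xt \<omega> $ j" and x\<^sub>0 = "\<lambda>j. x\<^sub>0 $ j" and e = e and B = B
                and n = n and p = p and lam\<^sub>1 = lam\<^sub>1 and lam\<^sub>2 = lam\<^sub>2 and \<kappa> = "l / 8",
              unfolded J H s(1)[symmetric] h[symmetric], OF opt eps lam_pos _ re] assms
          unfolding v_def by simp
        also have "\<dots> = G * \<tau> * sqrt (real (max s h))"
          using assms by (simp add: G_def lam field_simps)
        finally have "(L2_set v {..<p})\<^sup>2 \<le> (G * \<tau> * sqrt (real (max s h)))\<^sup>2"
          by (intro power_mono L2_set_nonneg)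
        moreover have "vec_l2_norm (xt \<omega> - x\<^sub>0) = L2_set v {..<p}"
          using xt x\<^sub>0 by (auto simp: vec_l2_norm_def v_def intro!: L2_set_cong)
        moreover have "(G * \<tau> * sqrt (real (max s h)))\<^sup>2 = G\<^sup>2 * \<sigma>\<^sup>2 * ln q * real (max s h)"
          using q by (simp add: \<tau>_def power_mult_distrib)
        ultimately show ?thesis by simp
      qed
      show "\<exists>E \<in> sets (sample_law n Na Ne).
         measure (sample_law n Na Ne) E
           \<ge> 1 - 2 / real (max p n) - real p * exp (- real n) - 1 * exp (- (1/8 * real n)) \<and>
         (\<forall>\<omega>\<in>E. (vec_l2_norm (xt \<omega> - x\<^sub>0))\<^sup>2
                   \<le> G\<^sup>2 * \<sigma>\<^sup>2 * ln (real (max p n)) * real (max s h))"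
        using E E_meas card_T noise bound unfolding q_def[symmetric] by (intro bexI[of _ E]) auto
    qed
  qed
  show ?thesis
    by (rule exI[of _ 21], intro conjI, simp, rule exI[of _ 1], intro conjI, simp, intro allI impI) (rule main)
qed

end
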